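(* Let $0<\beta<1$, $x_0>0$, $0\le\mu<1$ and $p>1/\beta$. Assume: (1) $\phi$ is a nonnegative, continuous and nondecreasing function on $[0,+\infty)$, and there exists a nonnegative constant $M$ such that $|\phi(t)|\le M t^{\mu}$ for all $t\in[0,+\infty)$; (2) $t^{\beta}l(t)$ is a nonnegative, continuous and nonincreasing function on $(0,+\infty)$, and $t^{(1-\mu)(1-\beta)}l(t)\in L^{p}[0,1]$; (3) $t^{\beta}k(t)$ is a nonnegative, continuous and nonincreasing function on $(0,+\infty)$, and $t^{1-\beta}k(t)\in L^{p}[0,1]$. Let $a=\lim_{t\to+\infty}t^{\beta}l(t)$ and $b=\lim_{t\to+\infty}t^{\beta}k(t)$ (these limits exist by monotonicity), and assume $a=0$. Then the Riemann-Liouville fractional differential equation $$D_{0^{+}}^{\beta}x(t)=l(t)\phi(x(t))+k(t),\quad t\in(0,+\infty),\qquad \lim_{t\to0^{+}}t^{1-\beta}x(t)=x_{0},$$ has at least one decreasing solution $x\in C^{+}_{1-\beta}(0,+\infty)$ with $$\lim_{t\to+\infty}x(t)=\frac{b\pi}{\Gamma(\beta)\sin(\beta\pi)}.$$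
   Context: The Riemann-Liouville fractional integral of order $\alpha\in(0,1)$ is $I_{0^{+}}^{\alpha}\rho(t)=\frac{1}{\Gamma(\alpha)}\int_{0}^{t}(t-s)^{\alpha-1}\rho(s)\,ds$. The Riemann-Liouville fractional derivative of order $\beta\in(0,1)$ is $D_{0^{+}}^{\beta}\rho(t)=\frac{d}{dt}I_{0^{+}}^{1-\beta}\rho(t)=\frac{1}{\Gamma(1-\beta)}\frac{d}{dt}\int_{0}^{t}(t-s)^{-\beta}\rho(s)\,ds$, where $I_{0^{+}}^{1-\beta}\rho$ is an absolutely continuous function. For $\alpha\in(0,1)$, $C^{+}_{\alpha}(0,+\infty)$ is the set of nonnegative continuous functions $x$ on $(0,+\infty)$ such that $t^{\alpha}x(t)$ is (extends to) a nonnegative continuous function on $[0,+\infty)$. A solution is a function satisfying both the differential equation for all $t\in(0,+\infty)$ and the initial condition. "Decreasing" means strictly decreasing, as distinguished from "nonincreasing". When $\mu=0$, $t^{\mu}=1$ for all $t\ge0$, including $t=0$. *)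

theory Defs
  imports "HOL-Analysis.Analysis"
begin

(* Unlike powr, this power has value 1 at base 0 and exponent 0. *)
definition rpow :: "real \<Rightarrow> real \<Rightarrow> real" where
  "rpow t \<mu> = (if \<mu> = 0 then 1 else t powr \<mu>)"

definition Lp_on :: "real \<Rightarrow> real set \<Rightarrow> (real \<Rightarrow> real) \<Rightarrow> bool" where
  "Lp_on p S f \<longleftrightarrow>
     set_borel_measurable lebesgue S f \<and> set_integrable lebesgue S (\<lambda>t. \<bar>f t\<bar> powr p)"

definition abs_continuous_on :: "real set \<Rightarrow> (real \<Rightarrow> real) \<Rightarrow> bool" where
  "abs_continuous_on S f \<longleftrightarrow>
     (\<forall>\<epsilon>>0. \<exists>\<delta>>0. \<forall>(n::nat) (u::nat \<Rightarrow> real) v.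
        (\<forall>i<n. u i \<le> v i \<and> {u i..v i} \<subseteq> S) \<and>
        (\<forall>i<n. \<forall>j<n. i \<noteq> j \<longrightarrow> {u i<..<v i} \<inter> {u j<..<v j} = {}) \<and>
        (\<Sum>i<n. v i - u i) < \<delta>
        \<longrightarrow> (\<Sum>i<n. \<bar>f (v i) - f (u i)\<bar>) < \<epsilon>)"

definition rl_integral :: "real \<Rightarrow> (real \<Rightarrow> real) \<Rightarrow> real \<Rightarrow> real" where
  "rl_integral \<alpha> \<rho> t =
     1 / Gamma \<alpha> * (LINT s:{0..t}|lebesgue. (t - s) powr (\<alpha> - 1) * \<rho> s)"

(* has_rl_derivative \<beta> \<rho> y: the Riemann-Liouville derivative of \<rho> of order \<beta> exists at every
   point of (0, \<infinity>) and equals y there.  The integrability clause rules out the default value 0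
   of an undefined Lebesgue integral.  Absolute continuity is required on the half-open intervals
   (0, T]; it amounts to absolute continuity on [0, T] after extension by the limit at 0+.
   The value at 0 itself is not used: rl_integral is 0 there by the formula, whereas for
   functions behaving like t powr (\<beta> - 1) near 0 the limit at 0+ is not 0. *)
definition has_rl_derivative ::
    "real \<Rightarrow> (real \<Rightarrow> real) \<Rightarrow> (real \<Rightarrow> real) \<Rightarrow> bool" where
  "has_rl_derivative \<beta> \<rho> y \<longleftrightarrow>
     (\<forall>t>0. set_integrable lebesgue {0..t} (\<lambda>s. (t - s) powr (- \<beta>) * \<rho> s)) \<and>
     (\<forall>T>0. abs_continuous_on {0<..T} (rl_integral (1 - \<beta>) \<rho>)) \<and>
     (\<forall>t>0. (rl_integral (1 - \<beta>) \<rho> has_real_derivative y t) (at t))"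

(* Only the values on (0, \<infinity>) matter. *)
definition Cplus :: "real \<Rightarrow> (real \<Rightarrow> real) set" where
  "Cplus \<alpha> = {x. continuous_on {0<..} x \<and> (\<forall>t>0. 0 \<le> x t) \<and>
     (\<exists>g. continuous_on {0..} g \<and> (\<forall>t\<ge>0. 0 \<le> g t) \<and> (\<forall>t>0. g t = t powr \<alpha> * x t))}"

definition rl_solution ::
    "real \<Rightarrow> (real \<Rightarrow> real) \<Rightarrow> (real \<Rightarrow> real) \<Rightarrow> (real \<Rightarrow> real) \<Rightarrow> real \<Rightarrow> (real \<Rightarrow> real) \<Rightarrow> bool" where
  "rl_solution \<beta> l \<phi> k x0 x \<longleftrightarrow>
     has_rl_derivative \<beta> x (\<lambda>t. l t * \<phi> (x t) + k t) \<and>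
     ((\<lambda>t. t powr (1 - \<beta>) * x t) \<longlongrightarrow> x0) (at_right 0)"

end

theory Submission
  imports Defs
begin

text \<open>
  For positive \<open>t\<close> a solution is obtained from the Volterra equation
  \<open>x t = x0 * t powr (\<beta> - 1) + (I\<^sup>\<beta> f) t\<close>, where \<open>f s = l s * \<phi> (x s) + k s\<close>
  and \<open>I\<^sup>\<beta>\<close> is the fractional integral from the origin.
  Write \<open>g s = s powr \<beta> * f s\<close>. Substituting \<open>s = t * u\<close> shows that \<open>Gamma \<beta> * (I\<^sup>\<beta> f) t\<close> is the mean of
  \<open>\<lambda>u. g (t * u)\<close> against the kernel \<open>u powr (- \<beta>) * (1 - u) powr (\<beta> - 1)\<close> on the unit interval. If \<open>x\<close> is
  decreasing, then \<open>g\<close> is nonincreasing, hence so is its mean in \<open>t\<close>, and the free term makes the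
  right-hand side strictly decreasing.

  The operator preserves the pointwise order because \<open>\<phi>\<close> is nondecreasing, so monotone iteration from
  the free term replaces a compactness argument (\<open>monotone_abel_fixed_point\<close>). It needs an upper bound.
  Since \<open>s powr \<beta> * l s\<close> and \<open>s powr \<beta> * k s\<close> are nonincreasing, the \<open>L\<^sup>p\<close> conditions become pointwise bounds
  (\<open>Lp_antimono_pointwise_bound\<close>). If \<open>x t \<le> R * t powr (\<beta> - 1)\<close> on \<open>(0, 1]\<close>, these give
  \<open>g s \<le> (c * R powr \<mu> + d) * s powr e\<close> there, with \<open>e = 2 * \<beta> - 1 - 1 / p > \<beta> - 1\<close>. The right-hand side is
  then at most \<open>(x0 + c' * R powr \<mu> + d') * t powr (\<beta> - 1)\<close> on \<open>(0, 1]\<close>, and \<open>\<mu> < 1\<close> allows a choice of \<open>R\<close> that reproduces the bound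
  (\<open>sublinear_absorption\<close>); beyond 1, decreasing functions are bounded by their value at 1.

  The fixed point has the required properties. The estimate for small \<open>t\<close> makes
  \<open>t powr (1 - \<beta>) * (I\<^sup>\<beta> f) t\<close> tend to 0, which is the initial condition. The mean of a monotone function
  is continuous (\<open>abel_mean_continuous\<close>), hence so are \<open>x\<close> and \<open>f\<close>. The semigroup law
  (\<open>nn_integral_abel_inversion\<close>) identifies \<open>I\<^sup>1\<^sup>-\<^sup>\<beta> x\<close> with \<open>x0 * Gamma \<beta>\<close> plus the ordinary primitive of \<open>f\<close>, which
  is absolutely continuous with derivative \<open>f\<close>. Finally \<open>g\<close> tends to \<open>b\<close>, because \<open>\<phi> (x s)\<close> is bounded for large \<open>s\<close>
  and \<open>a = 0\<close>, so its mean tends to \<open>b\<close> times the mass \<open>pi / sin (\<beta> * pi)\<close> of the kernel.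
\<close>

section \<open>Beta integrals\<close>

lemma Beta_reflection_real:
  fixes \<beta> :: real assumes "0 < \<beta>" "\<beta> < 1"
  shows "Gamma \<beta> * Gamma (1 - \<beta>) = pi / sin (\<beta> * pi)"
proof -
  have "complex_of_real (Gamma \<beta> * Gamma (1 - \<beta>)) = Gamma (of_real \<beta>) * Gamma (1 - of_real \<beta>)"
    by (simp flip: Gamma_complex_of_real)
  also have "\<dots> = of_real pi / sin (of_real pi * of_real \<beta>)"
    by (rule Gamma_reflection_complex)
  also have "\<dots> = complex_of_real (pi / sin (\<beta> * pi))"
    by (simp add: sin_of_real mult.commute flip: of_real_mult)
  finally show ?thesis by (simp only: of_real_eq_iff)
qed

lemma nn_integral_Beta_interval:
  fixes a b c d :: real
  assumes "0 < a" "0 < b" "c < d"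
  shows "(\<integral>\<^sup>+s. ennreal (indicator {c<..<d} s * ((s - c) powr (a - 1) * (d - s) powr (b - 1))) \<partial>lborel)
         = ennreal ((d - c) powr (a + b - 1) * Beta a b)"
proof -
  let ?f = "\<lambda>s. indicator {c<..<d} s * ((s - c) powr (a - 1) * (d - s) powr (b - 1))"
  have "((\<lambda>t. t powr (a - 1) * (1 - t) powr (b - 1)) has_integral Beta a b) {0<..<1}"
    using has_integral_Beta_real[OF assms(1,2)] by (simp add: has_integral_Icc_iff_Ioo)
  from nn_integral_has_integral_lebesgue[OF _ this]
  have unit: "(\<integral>\<^sup>+t. ennreal (indicator {0<..<1} t * (t powr (a - 1) * (1 - t) powr (b - 1))) \<partial>lborel)
      = ennreal (Beta a b)" by simp
  have "(\<integral>\<^sup>+s. ennreal (?f s) \<partial>lborel)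
      = ennreal \<bar>d - c\<bar> * (\<integral>\<^sup>+t. ennreal (?f (c + (d - c) * t)) \<partial>lborel)"
    using assms by (intro nn_integral_real_affine) auto
  also have "(\<lambda>t. ennreal (?f (c + (d - c) * t)))
     = (\<lambda>t. ennreal ((d - c) powr (a + b - 2)) *
            ennreal (indicator {0<..<1} t * (t powr (a - 1) * (1 - t) powr (b - 1))))"
  proof
    fix t
    have i: "indicator {c<..<d} (c + (d - c) * t) = (indicator {0<..<1} t :: real)"
    proof -
      have "c + (d - c) * t < d \<longleftrightarrow> (d - c) * t < (d - c) * 1" by auto
      also have "\<dots> \<longleftrightarrow> t < 1" using assms by (subst mult_less_cancel_left_pos) auto
      finally show ?thesis using assms by (auto simp: indicator_def zero_less_mult_iff)
    qed
    show "ennreal (?f (c + (d - c) * t)) = ennreal ((d - c) powr (a + b - 2)) *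
            ennreal (indicator {0<..<1} t * (t powr (a - 1) * (1 - t) powr (b - 1)))"
    proof (cases "t \<in> {0<..<1}")
      case True
      have e1: "d - (c + (d - c) * t) = (d - c) * (1 - t)" by (simp add: algebra_simps)
      have "?f (c + (d - c) * t) = ((d - c) * t) powr (a - 1) * ((d - c) * (1 - t)) powr (b - 1)"
        using True unfolding i e1 by simp
      also have "\<dots> = ((d - c) powr (a - 1) * (d - c) powr (b - 1)) * (t powr (a - 1) * (1 - t) powr (b - 1))"
        using True assms by (simp add: powr_mult)
      also have "(d - c) powr (a - 1) * (d - c) powr (b - 1) = (d - c) powr (a + b - 2)"
        by (simp flip: powr_add add: algebra_simps)
      finally show ?thesis using True by (simp add: ennreal_mult)
    qed (simp add: i)
  qed
  also have "(\<integral>\<^sup>+t. ennreal ((d - c) powr (a + b - 2)) *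
            ennreal (indicator {0<..<1} t * (t powr (a - 1) * (1 - t) powr (b - 1))) \<partial>lborel)
     = ennreal ((d - c) powr (a + b - 2)) * ennreal (Beta a b)"
    by (subst nn_integral_cmult) (auto simp: unit)
  also have "ennreal \<bar>d - c\<bar> * \<dots> = ennreal ((d - c) powr (1 + (a + b - 2)) * Beta a b)"
  proof -
    have "\<bar>d - c\<bar> * (d - c) powr (a + b - 2) = (d - c) powr (1 + (a + b - 2))"
      using assms by (simp only: powr_add) simp
    moreover have "Beta a b \<ge> 0" using assms by (simp add: Beta_def Gamma_real_pos less_imp_le)
    ultimately show ?thesis by (simp flip: ennreal_mult mult.assoc)
  qed
  finally show ?thesis by (simp add: algebra_simps)
qed

section \<open>Averages against the scaled Abel kernel\<close>

text \<open>
  Up to the factor \<open>1 / Gamma \<beta>\<close>, the fractional integral of \<open>\<lambda>s. s powr (- \<beta>) * g s\<close> at \<open>t\<close> is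
  the mean of \<open>\<lambda>u. g (t * u)\<close> against this fixed kernel: the substitution \<open>s = t * u\<close> removes all
  powers of \<open>t\<close>. The point \<open>t\<close> enters only as a dilation of \<open>g\<close>, so that monotonicity, continuity and
  the limit at infinity pass from \<open>g\<close> to its mean.
\<close>
definition abel_kernel :: "real \<Rightarrow> real \<Rightarrow> real" where
  "abel_kernel \<beta> u = indicator {0<..<1} u * (u powr (- \<beta>) * (1 - u) powr (\<beta> - 1))"

definition abel_mean :: "real \<Rightarrow> (real \<Rightarrow> real) \<Rightarrow> real \<Rightarrow> real" where
  "abel_mean \<beta> g t = (LINT u|lborel. abel_kernel \<beta> u * g (t * u))"

text \<open>
  The weighted sources \<open>g s = s powr \<beta> * f s\<close> to which the means are applied. The power bound
  controls the origin, and monotonicity gives the bound \<open>g 1\<close> beyond 1. The mean is finite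
  as soon as \<open>e > \<beta> - 1\<close>, and \<open>C\<close> will be the same along the whole iteration.
\<close>
definition decreasing_source :: "real \<Rightarrow> real \<Rightarrow> (real \<Rightarrow> real) \<Rightarrow> bool" where
  "decreasing_source e C g \<longleftrightarrow> antimono_on {0<..} g \<and> (\<forall>s>0. 0 \<le> g s) \<and> (\<forall>s. 0 < s \<and> s \<le> 1 \<longrightarrow> g s \<le> C * s powr e)"

lemma abel_kernel_measurable [measurable]: "abel_kernel \<beta> \<in> borel_measurable borel"
  unfolding abel_kernel_def by measurable

lemma abel_kernel_nonneg: "0 \<le> abel_kernel \<beta> u"
  unfolding abel_kernel_def by (auto simp: indicator_def)

lemma abel_kernel_moment:
  assumes "0 < \<beta>" "\<beta> - 1 < e"
  shows "has_bochner_integral lborel (\<lambda>u. abel_kernel \<beta> u * u powr e) (Beta (e + 1 - \<beta>) \<beta>)"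
proof -
  have eq: "abel_kernel \<beta> u * u powr e =
      indicator {0<..<1} u * ((u - 0) powr ((e + 1 - \<beta>) - 1) * (1 - u) powr (\<beta> - 1))" for u
    by (auto simp: abel_kernel_def indicator_def algebra_simps simp flip: powr_add)
  show ?thesis
    using nn_integral_Beta_interval[of "e + 1 - \<beta>" \<beta> 0 1] assms
    unfolding eq
    by (intro has_bochner_integral_nn_integral)
       (auto simp: Beta_def Gamma_real_pos less_imp_le)
qed

text \<open>
  Monotonicity only concerns the positive half-line, so a source may be arbitrary, even nonmeasurable,
  elsewhere; hence the indicator.
\<close>
lemma antimono_measurable_pos:
  fixes g :: "real \<Rightarrow> real"
  assumes "antimono_on {0<..} g"
  shows "(\<lambda>s. indicator {0<..} s * g s) \<in> borel_measurable borel"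
proof -
  have "mono_on {0<..} (\<lambda>s. - g s)"
    using assms by (auto simp: monotone_on_def)
  then have "(\<lambda>s. - g s) \<in> borel_measurable (restrict_space borel {0<..})"
    by (rule borel_measurable_mono_on_fnc)
  then have "(\<lambda>s. - (- g s)) \<in> borel_measurable (restrict_space borel {0<..})"
    by (rule borel_measurable_uminus)
  then show ?thesis
    by (subst (asm) borel_measurable_restrict_space_iff) auto
qed

lemma abel_integrand_measurable:
  assumes g: "antimono_on {0<..} g" and t: "0 < t"
  shows "(\<lambda>u. abel_kernel \<beta> u * g (t * u)) \<in> borel_measurable borel"
proof -
  note [measurable] = antimono_measurable_pos[OF g]
  have "(\<lambda>u. abel_kernel \<beta> u * (indicator {0<..} (t * u) * g (t * u))) \<in> borel_measurable borel"
    using measurable_compose[OF _ antimono_measurable_pos[OF g], of "\<lambda>u. t * u" borel]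
    by measurable
  also have "(\<lambda>u. abel_kernel \<beta> u * (indicator {0<..} (t * u) * g (t * u)))
      = (\<lambda>u. abel_kernel \<beta> u * g (t * u))"
    using t by (auto simp: abel_kernel_def indicator_def zero_less_mult_iff)
  finally show ?thesis .
qed

lemma abel_integrand_dominated:
  assumes b: "0 < \<beta>" "\<beta> - 1 < e" and g: "decreasing_source e C g"
    and t: "0 < t" "t \<le> 1"
  shows "abel_kernel \<beta> u * g (t * u) \<le> C * t powr e * (abel_kernel \<beta> u * u powr e)"
proof (cases "u \<in> {0<..<1}")
  case True
  have "t * u \<le> 1 * 1" using True t by (intro mult_mono) auto
  then have "g (t * u) \<le> C * (t * u) powr e"
    using g True t by (auto simp: decreasing_source_def)
  also have "\<dots> = C * t powr e * u powr e" using True t by (simp add: powr_mult)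
  finally show ?thesis
    using mult_left_mono[OF _ abel_kernel_nonneg[of \<beta> u], of "g (t * u)" "C * t powr e * u powr e"]
    by (simp add: mult_ac)
qed (simp add: abel_kernel_def)

lemma abel_integrand_nonneg:
  assumes "decreasing_source e C g" "0 < t"
  shows "0 \<le> abel_kernel \<beta> u * g (t * u)"
proof (cases "u \<in> {0<..<1}")
  case True
  then show ?thesis using assms by (intro mult_nonneg_nonneg abel_kernel_nonneg) (auto simp: decreasing_source_def)
qed (simp add: abel_kernel_def)

lemma abel_integrand_antimono:
  assumes "antimono_on {0<..} g" "0 < s" "s \<le> t"
  shows "abel_kernel \<beta> u * g (t * u) \<le> abel_kernel \<beta> u * g (s * u)"
proof (cases "u \<in> {0<..<1}")
  case True
  then have "g (t * u) \<le> g (s * u)"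
    using assms monotone_onD[OF assms(1), of "s * u" "t * u"] by auto
  then show ?thesis by (intro mult_left_mono abel_kernel_nonneg)
qed (simp add: abel_kernel_def)

text \<open>
  For \<open>t > 1\<close> the power bound on \<open>g (t * u)\<close> is not available for all \<open>u\<close>, but there
  \<open>g (t * u) \<le> g u\<close>, which reduces to \<open>t = 1\<close>.
\<close>
lemma abel_integrable:
  assumes b: "0 < \<beta>" "\<beta> - 1 < e" and g: "decreasing_source e C g" and t: "0 < t"
  shows "integrable lborel (\<lambda>u. abel_kernel \<beta> u * g (t * u))"
proof -
  have anti: "antimono_on {0<..} g" using g by (simp add: decreasing_source_def)
  define m where "m = min t 1"
  have m: "0 < m" "m \<le> 1" "m \<le> t" using t by (auto simp: m_def)
  have "integrable lborel (\<lambda>u. C * m powr e * (abel_kernel \<beta> u * u powr e))"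
    using abel_kernel_moment[OF b] by (auto simp: has_bochner_integral_iff)
  then show ?thesis
  proof (rule Bochner_Integration.integrable_bound)
    show "(\<lambda>u. abel_kernel \<beta> u * g (t * u)) \<in> borel_measurable lborel"
      using abel_integrand_measurable[OF anti t] by simp
    show "AE u in lborel. norm (abel_kernel \<beta> u * g (t * u))
        \<le> norm (C * m powr e * (abel_kernel \<beta> u * u powr e))"
    proof (rule AE_I2)
      fix u
      show "norm (abel_kernel \<beta> u * g (t * u)) \<le> norm (C * m powr e * (abel_kernel \<beta> u * u powr e))"
        using abel_integrand_nonneg[OF g t, of \<beta> u] abel_integrand_antimono[OF anti m(1,3), of \<beta> u]
          abel_integrand_dominated[OF b g m(1,2), of u] unfolding real_norm_def by linarith
    qed
  qed
qed

lemma abel_mean_nonneg: "decreasing_source e C g \<Longrightarrow> 0 < t \<Longrightarrow> 0 \<le> abel_mean \<beta> g t"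
  unfolding abel_mean_def by (intro Bochner_Integration.integral_nonneg abel_integrand_nonneg)

lemma abel_mean_antimono:
  assumes b: "0 < \<beta>" "\<beta> - 1 < e" and g: "decreasing_source e C g" and "0 < s" "s \<le> t"
  shows "abel_mean \<beta> g t \<le> abel_mean \<beta> g s"
  unfolding abel_mean_def using assms
  by (intro integral_mono abel_integrable[OF b g] abel_integrand_antimono) (auto simp: decreasing_source_def)

lemma abel_mean_mono:
  assumes b: "0 < \<beta>" "\<beta> - 1 < e" and g: "decreasing_source e C g" "decreasing_source e D h" and "0 < t"
    and le: "\<And>s. 0 < s \<Longrightarrow> g s \<le> h s"
  shows "abel_mean \<beta> g t \<le> abel_mean \<beta> h t"
  unfolding abel_mean_def
proof (intro integral_mono abel_integrable[OF b g(1)] abel_integrable[OF b g(2)])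
  fix u
  show "abel_kernel \<beta> u * g (t * u) \<le> abel_kernel \<beta> u * h (t * u)"
  proof (cases "u \<in> {0<..<1}")
    case True
    then show ?thesis using le[of "t * u"] \<open>0 < t\<close> by (intro mult_left_mono abel_kernel_nonneg) auto
  qed (simp add: abel_kernel_def)
qed fact+

lemma abel_mean_le:
  assumes b: "0 < \<beta>" "\<beta> - 1 < e" and g: "decreasing_source e C g" and t: "0 < t" "t \<le> 1"
  shows "abel_mean \<beta> g t \<le> C * t powr e * Beta (e + 1 - \<beta>) \<beta>"
proof -
  note m = abel_kernel_moment[OF b]
  have "abel_mean \<beta> g t \<le> (LINT u|lborel. C * t powr e * (abel_kernel \<beta> u * u powr e))"
    unfolding abel_mean_def using m
    by (intro integral_mono abel_integrable[OF b g] abel_integrand_dominated[OF b g] t)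
       (auto simp: has_bochner_integral_iff)
  also have "\<dots> = C * t powr e * Beta (e + 1 - \<beta>) \<beta>"
    using m by (auto simp: has_bochner_integral_iff)
  finally show ?thesis .
qed

lemma abel_mean_converges:
  assumes b: "0 < \<beta>" "\<beta> - 1 < e" and g: "\<And>n. decreasing_source e C (g n)"
    and t: "0 < t" and conv: "\<And>s. 0 < s \<Longrightarrow> (\<lambda>n. g n s) \<longlonglongrightarrow> h s" and h: "decreasing_source e C h"
    and le: "\<And>n s. 0 < s \<Longrightarrow> g n s \<le> h s"
  shows "(\<lambda>n. abel_mean \<beta> (g n) t) \<longlonglongrightarrow> abel_mean \<beta> h t"
  unfolding abel_mean_def
proof (rule integral_dominated_convergence[where w = "\<lambda>u. abel_kernel \<beta> u * h (t * u)"])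
  show "integrable lborel (\<lambda>u. abel_kernel \<beta> u * h (t * u))" by (rule abel_integrable[OF b h t])
  show "(\<lambda>u. abel_kernel \<beta> u * h (t * u)) \<in> borel_measurable lborel"
    using abel_integrand_measurable[of h t] h t by (simp add: decreasing_source_def)
  show "(\<lambda>u. abel_kernel \<beta> u * g n (t * u)) \<in> borel_measurable lborel" for n
    using abel_integrand_measurable[of "g n" t] g[of n] t by (simp add: decreasing_source_def)
  show "AE u in lborel. (\<lambda>n. abel_kernel \<beta> u * g n (t * u)) \<longlonglongrightarrow> abel_kernel \<beta> u * h (t * u)"
  proof (rule AE_I2)
    fix u
    show "(\<lambda>n. abel_kernel \<beta> u * g n (t * u)) \<longlonglongrightarrow> abel_kernel \<beta> u * h (t * u)"
    proof (cases "u \<in> {0<..<1}")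
      case True then show ?thesis using conv[of "t * u"] t by (intro tendsto_mult_left) auto
    qed (simp add: abel_kernel_def)
  qed
  show "AE u in lborel. norm (abel_kernel \<beta> u * g n (t * u)) \<le> abel_kernel \<beta> u * h (t * u)" for n
  proof (rule AE_I2)
    fix u
    have "abel_kernel \<beta> u * g n (t * u) \<le> abel_kernel \<beta> u * h (t * u)"
    proof (cases "u \<in> {0<..<1}")
      case True
      then show ?thesis using le[of "t * u" n] t by (intro mult_left_mono abel_kernel_nonneg) auto
    qed (simp add: abel_kernel_def)
    then show "norm (abel_kernel \<beta> u * g n (t * u)) \<le> abel_kernel \<beta> u * h (t * u)"
      using abel_integrand_nonneg[OF g t, of \<beta> u n] by simp
  qed
qed

text \<open>
  By dominated convergence with dominating function \<open>\<lambda>u. abel_kernel \<beta> u * g u\<close> (as \<open>g\<close> decreases);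
  the limit is \<open>L\<close> times the total mass of the kernel, which the reflection formula evaluates.
\<close>
lemma abel_mean_at_top:
  assumes b: "0 < \<beta>" "\<beta> < 1" "\<beta> - 1 < e" and g: "decreasing_source e C g" and lim: "(g \<longlongrightarrow> L) at_top"
  shows "(abel_mean \<beta> g \<longlongrightarrow> L * (pi / sin (\<beta> * pi))) at_top"
proof -
  have anti: "antimono_on {0<..} g" using g by (simp add: decreasing_source_def)
  have "((\<lambda>t. abel_mean \<beta> g t) \<longlongrightarrow> (LINT u|lborel. abel_kernel \<beta> u * L)) at_top"
    unfolding abel_mean_def
  proof (rule tendsto_at_topI_sequentially)
    fix X :: "nat \<Rightarrow> real" assume X: "filterlim X at_top sequentially"
    then obtain N where N: "\<And>n. n \<ge> N \<Longrightarrow> 1 \<le> X n"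
      by (auto simp: filterlim_at_top eventually_sequentially)
    show "(\<lambda>n. LINT u|lborel. abel_kernel \<beta> u * g (X n * u)) \<longlonglongrightarrow> (LINT u|lborel. abel_kernel \<beta> u * L)"
    proof (rule LIMSEQ_offset[where k = N],
           rule integral_dominated_convergence[where w = "\<lambda>u. abel_kernel \<beta> u * g (1 * u)"])
      show "integrable lborel (\<lambda>u. abel_kernel \<beta> u * g (1 * u))"
        by (rule abel_integrable[OF b(1,3) g]) simp
      show "(\<lambda>u. abel_kernel \<beta> u * g (X (n + N) * u)) \<in> borel_measurable lborel" for n
        using abel_integrand_measurable[OF anti, of "X (n + N)"] N[of "n + N"] by simp
      show "AE u in lborel. (\<lambda>n. abel_kernel \<beta> u * g (X (n + N) * u)) \<longlonglongrightarrow> abel_kernel \<beta> u * L"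
      proof (rule AE_I2)
        fix u
        show "(\<lambda>n. abel_kernel \<beta> u * g (X (n + N) * u)) \<longlonglongrightarrow> abel_kernel \<beta> u * L"
        proof (cases "u \<in> {0<..<1}")
          case True
          have "filterlim (\<lambda>n. X (n + N)) at_top sequentially"
            using X by (rule filterlim_compose) (rule filterlim_add_const_nat_at_top)
          then have "filterlim (\<lambda>n. X (n + N) * u) at_top sequentially"
            using True by (intro filterlim_at_top_mult_tendsto_pos[where f = "\<lambda>_. u" and c = u]) auto
          then show ?thesis by (intro tendsto_mult_left filterlim_compose[OF lim])
        qed (simp add: abel_kernel_def)
      qed
      show "AE u in lborel. norm (abel_kernel \<beta> u * g (X (n + N) * u)) \<le> abel_kernel \<beta> u * g (1 * u)" for n
        using N[of "n + N"] abel_integrand_nonneg[OF g, of "X (n + N)" \<beta>]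
          abel_integrand_antimono[OF anti, of 1 "X (n + N)" \<beta>]
        by (intro AE_I2) (simp only: real_norm_def abs_of_nonneg, simp)
    qed measurable
  qed
  also have "(LINT u|lborel. abel_kernel \<beta> u * L) = Beta (1 - \<beta>) \<beta> * L"
  proof -
    have "(\<lambda>u. abel_kernel \<beta> u * u powr 0) = abel_kernel \<beta>"
      by (auto simp: abel_kernel_def fun_eq_iff)
    with abel_kernel_moment[of \<beta> 0] b have "has_bochner_integral lborel (abel_kernel \<beta>) (Beta (1 - \<beta>) \<beta>)"
      by simp
    then show ?thesis by (auto simp: has_bochner_integral_iff)
  qed
  also have "Beta (1 - \<beta>) \<beta> = pi / sin (\<beta> * pi)"
    using Beta_reflection_real[OF b(1,2)] by (simp add: Beta_def mult.commute)
  finally show ?thesis by (simp add: mult.commute)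
qed

text \<open>
  A monotone function has countably many jumps, and the \<open>u\<close> for which \<open>t * u\<close> is one of them form
  a null set, so dominated convergence applies. This is what turns the limit of the iteration, of which only
  monotonicity is known at first, into a continuous function.
\<close>
lemma abel_mean_continuous:
  assumes b: "0 < \<beta>" "\<beta> - 1 < e" and g: "decreasing_source e C g"
  shows "continuous_on {0<..} (abel_mean \<beta> g)"
proof -
  have anti: "antimono_on {0<..} g" using g by (simp add: decreasing_source_def)
  define D where "D = {s \<in> {0<..}. \<not> isCont (\<lambda>s. - g s) s}"
  \<comment> \<open>Countability of the jumps is used for a nondecreasing function, hence the sign.\<close>
  have "countable D"
    unfolding D_def using anti by (intro mono_on_ctble_discont_open) (auto simp: monotone_on_def)
  have "isCont (abel_mean \<beta> g) t" if t: "0 < t" for t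
  proof (rule continuous_at_sequentiallyI)
    fix X :: "nat \<Rightarrow> real" assume X: "X \<longlonglongrightarrow> t"
    then obtain N where N: "\<And>n. n \<ge> N \<Longrightarrow> t / 2 < X n"
      using order_tendstoD(1)[OF X, of "t / 2"] t by (auto simp: eventually_sequentially)
    have "countable ((\<lambda>s. s / t) ` D)" using \<open>countable D\<close> by simp
    then have ae: "AE u in lborel. u \<notin> (\<lambda>s. s / t) ` D"
      by (intro AE_not_in countable_imp_null_set_lborel)
    show "(\<lambda>n. abel_mean \<beta> g (X n)) \<longlonglongrightarrow> abel_mean \<beta> g t"
      unfolding abel_mean_def
    proof (rule LIMSEQ_offset[where k = N],
           rule integral_dominated_convergence[where w = "\<lambda>u. abel_kernel \<beta> u * g (t / 2 * u)"])
      show "integrable lborel (\<lambda>u. abel_kernel \<beta> u * g (t / 2 * u))"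
        using t by (intro abel_integrable[OF b g]) simp
      show "(\<lambda>u. abel_kernel \<beta> u * g (X (n + N) * u)) \<in> borel_measurable lborel" for n
        using abel_integrand_measurable[OF anti, of "X (n + N)"] N[of "n + N"] t by simp
      show "(\<lambda>u. abel_kernel \<beta> u * g (t * u)) \<in> borel_measurable lborel"
        using abel_integrand_measurable[OF anti t] by simp
      show "AE u in lborel. (\<lambda>n. abel_kernel \<beta> u * g (X (n + N) * u)) \<longlonglongrightarrow> abel_kernel \<beta> u * g (t * u)"
        using ae
      proof eventually_elim
        fix u assume u: "u \<notin> (\<lambda>s. s / t) ` D"
        show "(\<lambda>n. abel_kernel \<beta> u * g (X (n + N) * u)) \<longlonglongrightarrow> abel_kernel \<beta> u * g (t * u)"
        proof (cases "u \<in> {0<..<1}")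
          case True
          have "t * u \<notin> D"
          proof
            assume "t * u \<in> D"
            then have "(t * u) / t \<in> (\<lambda>s. s / t) ` D" by blast
            then show False using u t by simp
          qed
          then have "isCont (\<lambda>s. - g s) (t * u)" using True t unfolding D_def by auto
          then have "isCont (\<lambda>s. - (- g s)) (t * u)" by (rule continuous_minus)
          then have "isCont g (t * u)" by simp
          moreover have "(\<lambda>n. X (n + N) * u) \<longlonglongrightarrow> t * u"
            using LIMSEQ_ignore_initial_segment[OF X, of N] by (intro tendsto_mult_right)
          ultimately show ?thesis by (intro tendsto_mult_left isCont_tendsto_compose[of _ g])
        qed (simp add: abel_kernel_def)
      qed
      show "AE u in lborel. norm (abel_kernel \<beta> u * g (X (n + N) * u)) \<le> abel_kernel \<beta> u * g (t / 2 * u)" for n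
        using N[of "n + N"] t abel_integrand_nonneg[OF g, of "X (n + N)" \<beta>]
          abel_integrand_antimono[OF anti, of "t / 2" "X (n + N)" \<beta>]
        by (intro AE_I2) (simp only: real_norm_def abs_of_nonneg, simp)
    qed
  qed
  then show ?thesis by (intro continuous_at_imp_continuous_on) auto
qed

section \<open>Inverting the fractional integral\<close>

text \<open>
  The unweighted source \<open>f\<close> with \<open>g s = s powr \<beta> * f s\<close>, set to zero off the positive half-line so
  that it is Borel measurable on the whole line.
\<close>
definition abel_forcing :: "real \<Rightarrow> (real \<Rightarrow> real) \<Rightarrow> real \<Rightarrow> real" where
  "abel_forcing \<beta> g r = indicator {0<..} r * (r powr (- \<beta>) * g r)"

lemma abel_forcing_measurable:
  assumes "antimono_on {0<..} g" shows "abel_forcing \<beta> g \<in> borel_measurable borel"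
proof -
  note [measurable] = antimono_measurable_pos[OF assms]
  have "(\<lambda>r. r powr (- \<beta>) * (indicator {0<..} r * g r)) \<in> borel_measurable borel" by measurable
  then show ?thesis unfolding abel_forcing_def[abs_def] by (simp add: mult_ac)
qed

lemma abel_forcing_nonneg: "decreasing_source e C g \<Longrightarrow> 0 \<le> abel_forcing \<beta> g r"
  by (auto simp: abel_forcing_def decreasing_source_def indicator_def)

lemma nn_integral_abel_forcing:
  assumes b: "0 < \<beta>" "\<beta> - 1 < e" and g: "decreasing_source e C g" and t: "0 < t"
  shows "(\<integral>\<^sup>+r. ennreal (if 0 < r \<and> r < t then (t - r) powr (\<beta> - 1) else 0) *
            ennreal (abel_forcing \<beta> g r) \<partial>lborel) = ennreal (abel_mean \<beta> g t)"
proof -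
  have anti: "antimono_on {0<..} g" using g by (simp add: decreasing_source_def)
  note [measurable] = abel_forcing_measurable[OF anti, of \<beta>]
  let ?h = "\<lambda>r. ennreal (if 0 < r \<and> r < t then (t - r) powr (\<beta> - 1) else 0) * ennreal (abel_forcing \<beta> g r)"
  have "(\<integral>\<^sup>+r. ?h r \<partial>lborel) = ennreal \<bar>t\<bar> * (\<integral>\<^sup>+u. ?h (0 + t * u) \<partial>lborel)"
  proof (rule nn_integral_real_affine)
    show "?h \<in> borel_measurable borel" by measurable
  qed (use t in simp)
  also have "\<dots> = (\<integral>\<^sup>+u. ennreal \<bar>t\<bar> * ?h (0 + t * u) \<partial>lborel)"
    by (subst nn_integral_cmult) auto
  also have "\<dots> = (\<integral>\<^sup>+u. ennreal (abel_kernel \<beta> u * g (t * u)) \<partial>lborel)"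
  proof (rule nn_integral_cong)
    fix u
    show "ennreal \<bar>t\<bar> * ?h (0 + t * u) = ennreal (abel_kernel \<beta> u * g (t * u))"
    proof (cases "u \<in> {0<..<1}")
      case True
      have e: "t - t * u = t * (1 - u)" by (simp add: algebra_simps)
      have "t * ((t - t * u) powr (\<beta> - 1) * ((t * u) powr (- \<beta>) * g (t * u)))
          = (t powr 1 * t powr (\<beta> - 1) * t powr (- \<beta>)) * (u powr (- \<beta>) * (1 - u) powr (\<beta> - 1)) * g (t * u)"
        using True t unfolding e by (simp add: powr_mult mult_ac)
      also have "t powr 1 * t powr (\<beta> - 1) * t powr (- \<beta>) = 1"
        unfolding powr_add[symmetric] using t by simp
      finally have "t * ((t - t * u) powr (\<beta> - 1) * ((t * u) powr (- \<beta>) * g (t * u))) = abel_kernel \<beta> u * g (t * u)"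
        using True by (simp add: abel_kernel_def)
      moreover have "ennreal \<bar>t\<bar> * ?h (0 + t * u)
          = ennreal (t * ((t - t * u) powr (\<beta> - 1) * ((t * u) powr (- \<beta>) * g (t * u))))"
        using True t by (simp add: abel_forcing_def flip: ennreal_mult')
      ultimately show ?thesis by (simp only:)
    next
      case False
      then have "\<not> (0 < t * u \<and> t * u < t)" using t by (auto simp: zero_less_mult_iff)
      then have z: "(if 0 < 0 + t * u \<and> 0 + t * u < t then (t - (0 + t * u)) powr (\<beta> - 1) else 0) = 0" by auto
      have "abel_kernel \<beta> u = 0" using False by (simp add: abel_kernel_def)
      then show ?thesis by (simp only: z) simp
    qed
  qed
  also have "\<dots> = ennreal (abel_mean \<beta> g t)"
    unfolding abel_mean_def
    by (intro nn_integral_eq_integral abel_integrable[OF b g t] AE_I2 abel_integrand_nonneg[OF g t])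
  finally show ?thesis .
qed

text \<open>
  The semigroup law for the fractional integrals of orders \<open>1 - \<beta>\<close> and \<open>\<beta>\<close>. After exchanging the
  integrals by Tonelli, the inner one over \<open>r < s < t\<close> is a Beta integral whose value does not depend
  on \<open>r\<close> and \<open>t\<close>, because the exponents \<open>\<beta> - 1\<close> and \<open>- \<beta>\<close> add up to \<open>-1\<close>.
\<close>
lemma nn_integral_abel_inversion:
  fixes F :: "real \<Rightarrow> ennreal"
  assumes b: "0 < \<beta>" "\<beta> < 1" and [measurable]: "F \<in> borel_measurable borel"
  shows "(\<integral>\<^sup>+s. ennreal (if 0 < s \<and> s < t then (t - s) powr (- \<beta>) else 0) *
            (\<integral>\<^sup>+r. ennreal (if 0 < r \<and> r < s then (s - r) powr (\<beta> - 1) else 0) * F r \<partial>lborel) \<partial>lborel)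
       = ennreal (Gamma \<beta> * Gamma (1 - \<beta>)) * (\<integral>\<^sup>+r. indicator {0<..<t} r * F r \<partial>lborel)" (is "?L = _")
proof -
  let ?k = "\<lambda>s. ennreal (if 0 < s \<and> s < t then (t - s) powr (- \<beta>) else 0)"
  let ?m = "\<lambda>s r. ennreal (if 0 < r \<and> r < s then (s - r) powr (\<beta> - 1) else 0)"
  have "?L = (\<integral>\<^sup>+s. (\<integral>\<^sup>+r. ?k s * (?m s r * F r) \<partial>lborel) \<partial>lborel)"
    by (subst nn_integral_cmult) auto
  also have "\<dots> = (\<integral>\<^sup>+r. (\<integral>\<^sup>+s. ?k s * (?m s r * F r) \<partial>lborel) \<partial>lborel)"
    by (rule lborel_pair.Fubini'[symmetric]) measurable
  also have "\<dots> = (\<integral>\<^sup>+r. ennreal (Gamma \<beta> * Gamma (1 - \<beta>)) * (indicator {0<..<t} r * F r) \<partial>lborel)"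
  proof (rule nn_integral_cong)
    fix r
    show "(\<integral>\<^sup>+s. ?k s * (?m s r * F r) \<partial>lborel)
        = ennreal (Gamma \<beta> * Gamma (1 - \<beta>)) * (indicator {0<..<t} r * F r)"
    proof (cases "r \<in> {0<..<t}")
      case True
      have "(\<integral>\<^sup>+s. ?k s * (?m s r * F r) \<partial>lborel)
          = (\<integral>\<^sup>+s. ennreal (indicator {r<..<t} s * ((s - r) powr (\<beta> - 1) * (t - s) powr ((1 - \<beta>) - 1))) * F r \<partial>lborel)"
        using True by (intro nn_integral_cong) (auto simp: indicator_def ennreal_mult' mult_ac)
      also have "\<dots> = ennreal ((t - r) powr (\<beta> + (1 - \<beta>) - 1) * Beta \<beta> (1 - \<beta>)) * F r"
        using nn_integral_Beta_interval[of \<beta> "1 - \<beta>" r t] b True by (subst nn_integral_multc) auto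
      finally show ?thesis using True by (simp add: Beta_def)
    next
      case False
      then have "?k s * (?m s r * F r) = 0" for s by auto
      then have "(\<integral>\<^sup>+s. ?k s * (?m s r * F r) \<partial>lborel) = (\<integral>\<^sup>+s. 0 \<partial>(lborel :: real measure))"
        by (intro nn_integral_cong)
      then show ?thesis using False by simp
    qed
  qed
  also have "\<dots> = ennreal (Gamma \<beta> * Gamma (1 - \<beta>)) * (\<integral>\<^sup>+r. indicator {0<..<t} r * F r \<partial>lborel)"
    by (subst nn_integral_cmult) auto
  finally show ?thesis .
qed

text \<open>
  On \<open>(0, t)\<close> the Abel kernel \<open>(t - r) powr (\<beta> - 1)\<close> is at least \<open>t powr (\<beta> - 1)\<close>, so finiteness of
  the fractional integral at \<open>t\<close> already bounds the plain integral.
\<close>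
lemma abel_forcing_integrable:
  assumes b: "0 < \<beta>" "\<beta> < 1" "\<beta> - 1 < e" and g: "decreasing_source e C g" and t: "0 < t"
  shows "integrable lborel (\<lambda>r. indicator {0<..<t} r * abel_forcing \<beta> g r)"
proof (rule integrableI_bounded)
  have anti: "antimono_on {0<..} g" using g by (simp add: decreasing_source_def)
  note [measurable] = abel_forcing_measurable[OF anti, of \<beta>]
  show "(\<lambda>r. indicator {0<..<t} r * abel_forcing \<beta> g r) \<in> borel_measurable lborel" by measurable
  have "(\<integral>\<^sup>+r. ennreal (norm (indicator {0<..<t} r * abel_forcing \<beta> g r)) \<partial>lborel)
      \<le> (\<integral>\<^sup>+r. ennreal (t powr (1 - \<beta>)) * (ennreal (if 0 < r \<and> r < t then (t - r) powr (\<beta> - 1) else 0) *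
            ennreal (abel_forcing \<beta> g r)) \<partial>lborel)"
  proof (rule nn_integral_mono)
    fix r
    show "ennreal (norm (indicator {0<..<t} r * abel_forcing \<beta> g r))
      \<le> ennreal (t powr (1 - \<beta>)) * (ennreal (if 0 < r \<and> r < t then (t - r) powr (\<beta> - 1) else 0) *
            ennreal (abel_forcing \<beta> g r))"
    proof (cases "r \<in> {0<..<t}")
      case True
      have "t powr (\<beta> - 1) \<le> (t - r) powr (\<beta> - 1)"
        using True b by (intro powr_mono2') auto
      then have "t powr (1 - \<beta>) * t powr (\<beta> - 1) \<le> t powr (1 - \<beta>) * (t - r) powr (\<beta> - 1)"
        by (intro mult_left_mono) auto
      then have "1 \<le> t powr (1 - \<beta>) * (t - r) powr (\<beta> - 1)"
        using t by (simp flip: powr_add)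
      then have "1 * abel_forcing \<beta> g r \<le> t powr (1 - \<beta>) * (t - r) powr (\<beta> - 1) * abel_forcing \<beta> g r"
        by (intro mult_right_mono abel_forcing_nonneg[OF g])
      then show ?thesis using True abel_forcing_nonneg[OF g, of \<beta> r]
        by (simp flip: ennreal_mult' ennreal_mult add: mult.assoc ennreal_leI)
    qed auto
  qed
  also have "\<dots> = ennreal (t powr (1 - \<beta>)) * ennreal (abel_mean \<beta> g t)"
    by (subst nn_integral_cmult) (auto simp: nn_integral_abel_forcing[OF b(1,3) g t])
  also have "\<dots> < \<infinity>" by (simp add: ennreal_mult_less_top)
  finally show "(\<integral>\<^sup>+r. ennreal (norm (indicator {0<..<t} r * abel_forcing \<beta> g r)) \<partial>lborel) < \<infinity>" .
qed

definition abel_primitive :: "real \<Rightarrow> (real \<Rightarrow> real) \<Rightarrow> real \<Rightarrow> real" where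
  "abel_primitive \<beta> g t = (LINT r|lborel. indicator {0<..<t} r * abel_forcing \<beta> g r)"

text \<open>
  The right-hand side of the Volterra equation: the free term plus the fractional integral
  of order \<open>\<beta>\<close> of the source. The value 0 off the positive half-line makes it Borel measurable and
  makes the integrand of the fractional derivative vanish at the left end of \<open>[0, t]\<close>.
\<close>
definition volterra_rhs :: "real \<Rightarrow> real \<Rightarrow> (real \<Rightarrow> real) \<Rightarrow> real \<Rightarrow> real" where
  "volterra_rhs \<beta> x0 g t = (if 0 < t then x0 * t powr (\<beta> - 1) + abel_mean \<beta> g t / Gamma \<beta> else 0)"

lemma volterra_rhs_measurable:
  assumes b: "0 < \<beta>" "\<beta> - 1 < e" and g: "decreasing_source e C g"
  shows "volterra_rhs \<beta> x0 g \<in> borel_measurable borel"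
proof -
  have "antimono_on {0<..} (abel_mean \<beta> g)"
    using abel_mean_antimono[OF b g] by (auto simp: monotone_on_def)
  note [measurable] = antimono_measurable_pos[OF this]
  have "volterra_rhs \<beta> x0 g = (\<lambda>t. indicator {0<..} t * (x0 * t powr (\<beta> - 1))
      + (indicator {0<..} t * abel_mean \<beta> g t) / Gamma \<beta>)"
    by (auto simp: volterra_rhs_def fun_eq_iff)
  then show ?thesis by simp
qed

text \<open>
  Applying the fractional integral of order \<open>1 - \<beta>\<close> turns the free term \<open>x0 * t powr (\<beta> - 1)\<close> into the
  constant \<open>x0 * Gamma \<beta>\<close> (a Beta integral) and the fractional integral of the source into its
  ordinary primitive. Everything is nonnegative, so the computation in extended reals yields
  integrability and the value together.
\<close>
lemma rl_kernel_volterra_rhs: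
  assumes b: "0 < \<beta>" "\<beta> < 1" "\<beta> - 1 < e" and g: "decreasing_source e C g" and t: "0 < t" and x0: "0 \<le> x0"
  shows "has_bochner_integral lebesgue
     (\<lambda>s. indicator {0..t} s * ((t - s) powr (- \<beta>) * volterra_rhs \<beta> x0 g s))
     (Gamma (1 - \<beta>) * (x0 * Gamma \<beta> + abel_primitive \<beta> g t))"
proof -
  have anti: "antimono_on {0<..} g" using g by (simp add: decreasing_source_def)
  note [measurable] = abel_forcing_measurable[OF anti, of \<beta>] volterra_rhs_measurable[OF b(1,3) g, of x0]
  let ?f = "\<lambda>s. indicator {0..t} s * ((t - s) powr (- \<beta>) * volterra_rhs \<beta> x0 g s)"
  let ?k = "\<lambda>s. ennreal (if 0 < s \<and> s < t then (t - s) powr (- \<beta>) else 0)"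
  let ?J = "\<lambda>s. \<integral>\<^sup>+r. ennreal (if 0 < r \<and> r < s then (s - r) powr (\<beta> - 1) else 0) *
            ennreal (abel_forcing \<beta> g r) \<partial>lborel"
  have G: "Gamma \<beta> > 0" "Gamma (1 - \<beta>) > 0" using b by (auto intro: Gamma_real_pos)
  have fin: "(\<integral>\<^sup>+r. indicator {0<..<t} r * ennreal (abel_forcing \<beta> g r) \<partial>lborel) = ennreal (abel_primitive \<beta> g t)"
  proof -
    have "(\<integral>\<^sup>+r. indicator {0<..<t} r * ennreal (abel_forcing \<beta> g r) \<partial>lborel)
        = (\<integral>\<^sup>+r. ennreal (indicator {0<..<t} r * abel_forcing \<beta> g r) \<partial>lborel)"
      by (intro nn_integral_cong) (auto simp: indicator_def)
    also have "\<dots> = ennreal (abel_primitive \<beta> g t)"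
      unfolding abel_primitive_def
      by (intro nn_integral_eq_integral abel_forcing_integrable[OF b g t] AE_I2)
         (auto intro!: mult_nonneg_nonneg abel_forcing_nonneg[OF g])
    finally show ?thesis .
  qed
  have P: "abel_primitive \<beta> g t \<ge> 0"
    unfolding abel_primitive_def
    by (auto intro!: Bochner_Integration.integral_nonneg mult_nonneg_nonneg abel_forcing_nonneg[OF g])
  have nn: "volterra_rhs \<beta> x0 g s \<ge> 0" for s
    using abel_mean_nonneg[OF g, of s \<beta>] G x0 by (auto simp: volterra_rhs_def)
  have "has_bochner_integral lborel ?f (Gamma (1 - \<beta>) * (x0 * Gamma \<beta> + abel_primitive \<beta> g t))"
  proof (rule has_bochner_integral_nn_integral)
    show "?f \<in> borel_measurable lborel" by measurable
    show "AE s in lborel. 0 \<le> ?f s" using nn by (intro AE_I2) auto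
    show "0 \<le> Gamma (1 - \<beta>) * (x0 * Gamma \<beta> + abel_primitive \<beta> g t)" using G P x0 by simp
    have "(\<integral>\<^sup>+s. ennreal (?f s) \<partial>lborel) = (\<integral>\<^sup>+s. ennreal x0 * ennreal (indicator {0<..<t} s *
        ((s - 0) powr (\<beta> - 1) * (t - s) powr ((1 - \<beta>) - 1))) + ennreal (1 / Gamma \<beta>) * (?k s * ?J s) \<partial>lborel)"
    proof (rule nn_integral_cong)
      fix s
      show "ennreal (?f s) = ennreal x0 * ennreal (indicator {0<..<t} s *
        ((s - 0) powr (\<beta> - 1) * (t - s) powr ((1 - \<beta>) - 1))) + ennreal (1 / Gamma \<beta>) * (?k s * ?J s)"
      proof (cases "s \<in> {0<..<t}")
        case True
        have A: "abel_mean \<beta> g s \<ge> 0" using abel_mean_nonneg[OF g, of s \<beta>] True by simp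
        have J: "?J s = ennreal (abel_mean \<beta> g s)"
          using True by (intro nn_integral_abel_forcing[OF b(1,3) g]) simp
        have "?f s = x0 * (s powr (\<beta> - 1) * (t - s) powr (- \<beta>)) + 1 / Gamma \<beta> * ((t - s) powr (- \<beta>) * abel_mean \<beta> g s)"
          using True by (simp add: volterra_rhs_def algebra_simps)
        also have "ennreal \<dots> = ennreal x0 * ennreal (s powr (\<beta> - 1) * (t - s) powr (- \<beta>))
             + ennreal (1 / Gamma \<beta>) * (ennreal ((t - s) powr (- \<beta>)) * ennreal (abel_mean \<beta> g s))"
        proof -
          have "1 / Gamma \<beta> \<ge> 0" using G by simp
          then show ?thesis using A x0
            by (simp add: ennreal_plus ennreal_mult mult_nonneg_nonneg del: times_divide_eq_left mult_eq_0_iff)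
        qed
        finally show ?thesis unfolding J using True by simp
      next
        case False
        then have "s \<in> {0..t} \<Longrightarrow> s = 0 \<or> s = t" by auto
        then have "?f s = 0" by (auto simp: volterra_rhs_def indicator_def)
        then show ?thesis using False by auto
      qed
    qed
    also have "\<dots> = ennreal x0 * ennreal (Gamma \<beta> * Gamma (1 - \<beta>)) +
        ennreal (1 / Gamma \<beta>) * (ennreal (Gamma \<beta> * Gamma (1 - \<beta>)) * ennreal (abel_primitive \<beta> g t))"
      using nn_integral_Beta_interval[of \<beta> "1 - \<beta>" 0 t] b t
      by (simp add: nn_integral_add nn_integral_cmult nn_integral_abel_inversion fin Beta_def)
    also have "\<dots> = ennreal (x0 * (Gamma \<beta> * Gamma (1 - \<beta>)) + 1 / Gamma \<beta> * (Gamma \<beta> * Gamma (1 - \<beta>) * abel_primitive \<beta> g t))"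
      using G P x0 by (simp add: ennreal_plus ennreal_mult del: times_divide_eq_left)
    also have "x0 * (Gamma \<beta> * Gamma (1 - \<beta>)) + 1 / Gamma \<beta> * (Gamma \<beta> * Gamma (1 - \<beta>) * abel_primitive \<beta> g t)
        = Gamma (1 - \<beta>) * (x0 * Gamma \<beta> + abel_primitive \<beta> g t)"
      using G by (simp add: field_simps)
    finally show "(\<integral>\<^sup>+s. ennreal (?f s) \<partial>lborel) = ennreal (Gamma (1 - \<beta>) * (x0 * Gamma \<beta> + abel_primitive \<beta> g t))" .
  qed
  then show ?thesis
    by (simp add: has_bochner_integral_iff integrable_completion integral_completion)
qed

text \<open>
  Truncate \<open>H\<close> at height \<open>N\<close>: the excess \<open>K\<close> over \<open>N\<close> has small total integral for large \<open>N\<close>, and over disjoint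
  intervals the contributions of \<open>K\<close> add up to at most that, while the truncated part contributes at
  most \<open>N\<close> times the total length.
\<close>
lemma abs_continuous_on_integral:
  fixes H :: "real \<Rightarrow> real"
  assumes H: "integrable lborel H" and nn: "\<And>r. 0 \<le> H r"
    and Q: "\<And>u v. u \<in> S \<Longrightarrow> v \<in> S \<Longrightarrow> u \<le> v \<Longrightarrow> Q v - Q u = (LINT r|lborel. indicator {u<..<v} r * H r)"
  shows "abs_continuous_on S Q"
  unfolding abs_continuous_on_def
proof (intro allI impI)
  fix \<epsilon> :: real assume \<epsilon>: "\<epsilon> > 0"
  have [measurable]: "H \<in> borel_measurable borel" using borel_measurable_integrable[OF H] by simp
  have "(\<lambda>N. LINT r|lborel. H r - min (H r) (real N)) \<longlonglongrightarrow> (LINT r|(lborel::real measure). 0)"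
  proof (rule integral_dominated_convergence[where w = H])
    show "AE r in lborel. (\<lambda>N. H r - min (H r) (real N)) \<longlonglongrightarrow> 0"
    proof (rule AE_I2)
      fix r
      obtain N where N: "H r \<le> real N" using real_arch_simple by blast
      have "\<forall>\<^sub>F n in sequentially. H r - min (H r) (real n) = 0"
        using eventually_ge_at_top[of N] by eventually_elim (use N in auto)
      then show "(\<lambda>N. H r - min (H r) (real N)) \<longlonglongrightarrow> 0" by (rule tendsto_eventually)
    qed
    show "AE r in lborel. norm (H r - min (H r) (real N)) \<le> H r" for N
      using nn by (intro AE_I2) (auto simp: min_def)
  qed (use H in auto)
  then have "\<forall>\<^sub>F N in sequentially. (LINT r|lborel. H r - min (H r) (real N)) < \<epsilon> / 2"
    using \<epsilon> by (intro order_tendstoD(2)) auto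
  then obtain N :: nat where N: "(LINT r|lborel. H r - min (H r) (real N)) < \<epsilon> / 2"
    by (auto simp: eventually_sequentially)
  define K where "K r = H r - min (H r) (real N)" for r
  have K0: "K r \<ge> 0" for r by (simp add: K_def)
  have KI: "integrable lborel K"
    unfolding K_def using nn
    by (intro Bochner_Integration.integrable_diff H Bochner_Integration.integrable_bound[OF H]) auto
  have [measurable]: "K \<in> borel_measurable borel" using borel_measurable_integrable[OF KI] by simp
  show "\<exists>\<delta>>0. \<forall>(n::nat) u v. (\<forall>i<n. u i \<le> v i \<and> {u i..v i} \<subseteq> S) \<and>
         (\<forall>i<n. \<forall>j<n. i \<noteq> j \<longrightarrow> {u i<..<v i} \<inter> {u j<..<v j} = {}) \<and> (\<Sum>i<n. v i - u i) < \<delta> \<longrightarrow>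
         (\<Sum>i<n. \<bar>Q (v i) - Q (u i)\<bar>) < \<epsilon>"
  proof (intro exI[of _ "\<epsilon> / (2 * (real N + 1))"] conjI allI impI)
    show "0 < \<epsilon> / (2 * (real N + 1))" using \<epsilon> by simp
    fix n :: nat and u v :: "nat \<Rightarrow> real"
    assume *: "(\<forall>i<n. u i \<le> v i \<and> {u i..v i} \<subseteq> S) \<and>
         (\<forall>i<n. \<forall>j<n. i \<noteq> j \<longrightarrow> {u i<..<v i} \<inter> {u j<..<v j} = {}) \<and> (\<Sum>i<n. v i - u i) < \<epsilon> / (2 * (real N + 1))"
    have KIi: "integrable lborel (\<lambda>r. indicator {a<..<b} r * K r)" for a b
      by (rule Bochner_Integration.integrable_bound[OF KI]) (auto simp: indicator_def)
    have HIi: "integrable lborel (\<lambda>r. indicator {a<..<b} r * H r)" for a b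
      by (rule Bochner_Integration.integrable_bound[OF H]) (auto simp: indicator_def)
    have ind: "integrable lborel (\<lambda>r. real N * indicator {a<..<b} r)" for a b :: real
      by (intro integrable_mult_right integrable_real_indicator; cases "a \<le> b") auto
    have "\<bar>Q (v i) - Q (u i)\<bar> \<le> (LINT r|lborel. indicator {u i<..<v i} r * K r) + real N * (v i - u i)" if "i < n" for i
    proof -
      have "u i \<le> v i" "{u i..v i} \<subseteq> S" using * that by auto
      then have le: "u i \<le> v i" "u i \<in> S" "v i \<in> S" by auto
      have "\<bar>Q (v i) - Q (u i)\<bar> = (LINT r|lborel. indicator {u i<..<v i} r * H r)"
        using Q[OF le(2,3,1)] nn by (auto intro!: abs_of_nonneg Bochner_Integration.integral_nonneg)
      also have "\<dots> \<le> (LINT r|lborel. indicator {u i<..<v i} r * K r + real N * indicator {u i<..<v i} r)"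
        by (intro integral_mono HIi Bochner_Integration.integrable_add KIi ind) (auto simp: indicator_def K_def)
      also have "\<dots> = (LINT r|lborel. indicator {u i<..<v i} r * K r) + (LINT r|lborel. real N * indicator {u i<..<v i} r)"
        by (rule Bochner_Integration.integral_add[OF KIi ind])
      also have "(LINT r|lborel. real N * indicator {u i<..<v i} r) = real N * (v i - u i)"
        using le by simp
      finally show ?thesis .
    qed
    then have "(\<Sum>i<n. \<bar>Q (v i) - Q (u i)\<bar>)
        \<le> (\<Sum>i<n. (LINT r|lborel. indicator {u i<..<v i} r * K r) + real N * (v i - u i))"
      by (intro sum_mono) auto
    also have "\<dots> = (LINT r|lborel. (\<Sum>i<n. indicator {u i<..<v i} r * K r)) + real N * (\<Sum>i<n. v i - u i)"
      by (subst Bochner_Integration.integral_sum) (auto intro: KIi simp: sum.distrib sum_distrib_left)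
    also have "(LINT r|lborel. (\<Sum>i<n. indicator {u i<..<v i} r * K r)) \<le> (LINT r|lborel. K r)"
    proof (intro integral_mono KI Bochner_Integration.integrable_sum KIi)
      fix r
      have "disjoint_family_on (\<lambda>i. {u i<..<v i}) {..<n}" using * by (auto simp: disjoint_family_on_def)
      then have "(\<Sum>i<n. indicator {u i<..<v i} r) = (indicator (\<Union>i<n. {u i<..<v i}) r :: real)"
        by (subst indicator_UN_disjoint) auto
      also have "\<dots> \<le> 1" by (simp add: indicator_def)
      finally have "(\<Sum>i<n. indicator {u i<..<v i} r) * K r \<le> 1 * K r" using K0 by (intro mult_right_mono)
      then show "(\<Sum>i<n. indicator {u i<..<v i} r * K r) \<le> K r" by (simp add: sum_distrib_right)
    qed
    also have "(LINT r|lborel. K r) < \<epsilon> / 2" using N unfolding K_def .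
    also have "real N * (\<Sum>i<n. v i - u i) \<le> real N * (\<epsilon> / (2 * (real N + 1)))"
      using * by (intro mult_left_mono) auto
    also have "\<dots> \<le> \<epsilon> / 2" using \<epsilon> by (simp add: field_simps)
    finally show "(\<Sum>i<n. \<bar>Q (v i) - Q (u i)\<bar>) < \<epsilon>" by simp
  qed
qed

lemma abel_primitive_diff:
  assumes b: "0 < \<beta>" "\<beta> < 1" "\<beta> - 1 < e" and g: "decreasing_source e C g" and uv: "0 < u" "u \<le> v"
  shows "abel_primitive \<beta> g v - abel_primitive \<beta> g u
    = (LINT r|lborel. indicator {u<..<v} r * abel_forcing \<beta> g r)"
proof -
  have "abel_primitive \<beta> g v - abel_primitive \<beta> g u = (LINT r|lborel.
      indicator {0<..<v} r * abel_forcing \<beta> g r - indicator {0<..<u} r * abel_forcing \<beta> g r)"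
    unfolding abel_primitive_def using uv
    by (intro Bochner_Integration.integral_diff[symmetric] abel_forcing_integrable[OF b g]) auto
  also have "\<dots> = (LINT r|lborel. indicator {u<..<v} r * abel_forcing \<beta> g r)"
  proof (rule integral_cong_AE)
    have anti: "antimono_on {0<..} g" using g by (simp add: decreasing_source_def)
    note [measurable] = abel_forcing_measurable[OF anti, of \<beta>]
    show "(\<lambda>r. indicator {0<..<v} r * abel_forcing \<beta> g r - indicator {0<..<u} r * abel_forcing \<beta> g r) \<in> borel_measurable lborel"
      "(\<lambda>r. indicator {u<..<v} r * abel_forcing \<beta> g r) \<in> borel_measurable lborel" by measurable
    have "AE r in lborel. r \<noteq> u" by (rule AE_lborel_singleton)
    then show "AE r in lborel. indicator {0<..<v} r * abel_forcing \<beta> g r - indicator {0<..<u} r * abel_forcing \<beta> g r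
        = indicator {u<..<v} r * abel_forcing \<beta> g r"
      by eventually_elim (use uv in \<open>auto simp: indicator_def\<close>)
  qed
  finally show ?thesis .
qed

lemma abel_primitive_has_derivative:
  assumes b: "0 < \<beta>" "\<beta> < 1" "\<beta> - 1 < e" and g: "decreasing_source e C g" and cont: "continuous_on {0<..} g" and t: "0 < t"
  shows "(abel_primitive \<beta> g has_real_derivative t powr (- \<beta>) * g t) (at t)"
proof -
  let ?F = "\<lambda>r. r powr (- \<beta>) * g r"
  define c where "c = t / 2"
  have c: "0 < c" "c < t" using t by (auto simp: c_def)
  have F: "continuous_on {c..2 * t} ?F"
    using c by (intro continuous_intros continuous_on_subset[OF cont]) auto
  have "((\<lambda>x. integral {c..x} ?F) has_real_derivative ?F t) (at t within {c..2 * t})"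
    using c by (intro integral_has_real_derivative F) auto
  also have "at t within {c..2 * t} = at t" using c by (intro at_within_Icc_at) auto
  finally have D: "((\<lambda>x. abel_primitive \<beta> g c + integral {c..x} ?F) has_real_derivative ?F t) (at t)"
    by (auto intro!: derivative_eq_intros)
  show ?thesis
  proof (rule has_field_derivative_transform_within_open[OF D])
    show "open {c<..<2 * t}" "t \<in> {c<..<2 * t}" using c by auto
    fix x assume x: "x \<in> {c<..<2 * t}"
    have "set_integrable lborel {c..x} ?F"
      using x by (intro borel_integrable_atLeastAtMost' continuous_on_subset[OF F]) auto
    have si: "set_integrable lborel {c<..<x} ?F"
      by (rule set_integrable_subset[OF \<open>set_integrable lborel {c..x} ?F\<close>]) auto
    have "abel_primitive \<beta> g x - abel_primitive \<beta> g c = (LINT r|lborel. indicator {c<..<x} r * abel_forcing \<beta> g r)"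
      using x c by (intro abel_primitive_diff[OF b g]) auto
    also have "\<dots> = (LINT r:{c<..<x}|lborel. ?F r)"
      unfolding set_lebesgue_integral_def using c
      by (intro Bochner_Integration.integral_cong) (auto simp: abel_forcing_def indicator_def)
    also have "\<dots> = integral {c<..<x} ?F" by (rule set_borel_integral_eq_integral(2)[OF si])
    also have "\<dots> = integral {c..x} ?F" by (rule integral_open_interval_real[symmetric])
    finally show "abel_primitive \<beta> g c + integral {c..x} ?F = abel_primitive \<beta> g x" by simp
  qed
qed

lemma volterra_rhs_has_rl_derivative:
  assumes b: "0 < \<beta>" "\<beta> < 1" "\<beta> - 1 < e" and g: "decreasing_source e C g" and cont: "continuous_on {0<..} g" and x0: "0 \<le> x0"
    and y: "\<And>t. 0 < t \<Longrightarrow> y t = t powr (- \<beta>) * g t"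
  shows "has_rl_derivative \<beta> (volterra_rhs \<beta> x0 g) y"
proof -
  let ?x = "volterra_rhs \<beta> x0 g"
  note K = rl_kernel_volterra_rhs[OF b g _ x0]
  have G: "Gamma (1 - \<beta>) > 0" using b by (auto intro: Gamma_real_pos)
  have rl: "rl_integral (1 - \<beta>) ?x t = x0 * Gamma \<beta> + abel_primitive \<beta> g t" if "0 < t" for t
    using K[OF that] G by (simp add: rl_integral_def set_lebesgue_integral_def has_bochner_integral_iff)
  show ?thesis
    unfolding has_rl_derivative_def
  proof (intro conjI allI impI)
    fix t :: real assume t: "t > 0"
    show "set_integrable lebesgue {0..t} (\<lambda>s. (t - s) powr (- \<beta>) * ?x s)"
      using K[OF t] by (simp add: set_integrable_def has_bochner_integral_iff)
    have D: "((\<lambda>t. x0 * Gamma \<beta> + abel_primitive \<beta> g t) has_real_derivative y t) (at t)"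
      unfolding y[OF t] by (auto intro!: derivative_eq_intros abel_primitive_has_derivative[OF b g cont t])
    show "(rl_integral (1 - \<beta>) ?x has_real_derivative y t) (at t)"
      by (rule has_field_derivative_transform_within_open[OF D, of "{0<..}"]) (use t rl in auto)
  next
    fix T :: real assume T: "T > 0"
    show "abs_continuous_on {0<..T} (rl_integral (1 - \<beta>) ?x)"
    proof (rule abs_continuous_on_integral[OF abel_forcing_integrable[OF b g T]])
      show "0 \<le> indicator {0<..<T} r * abel_forcing \<beta> g r" for r
        by (intro mult_nonneg_nonneg abel_forcing_nonneg[OF g]) auto
      fix u v assume "u \<in> {0<..T}" "v \<in> {0<..T}" "u \<le> v"
      then show "rl_integral (1 - \<beta>) ?x v - rl_integral (1 - \<beta>) ?x u
          = (LINT r|lborel. indicator {u<..<v} r * (indicator {0<..<T} r * abel_forcing \<beta> g r))"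
        using abel_primitive_diff[OF b g, of u v]
        by (auto simp: rl indicator_def intro!: Bochner_Integration.integral_cong)
    qed
  qed
qed

section \<open>A priori bounds\<close>

text \<open>
  A monotone weight upgrades \<open>L\<^sup>p\<close> integrability to a pointwise bound, which takes the
  place of Hoelder's inequality in bounding the fractional integral. On \<open>[t / 2, t]\<close> the function \<open>s powr \<gamma> * l s\<close> is at least a fixed multiple \<open>c\<close> of its value \<open>L\<close>
  at \<open>t\<close>, since \<open>s powr \<beta> * l s\<close> is nonincreasing and the power \<open>s powr (\<gamma> - \<beta>)\<close> varies by a bounded factor; hence
  \<open>(c * L) powr p * (t / 2)\<close> is at most the integral over \<open>[0, 1]\<close> of the \<open>p\<close>-th power.
\<close>
lemma Lp_antimono_pointwise_bound:
  fixes l :: "real \<Rightarrow> real"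
  assumes p: "0 < p" and nn: "\<forall>t>0. 0 \<le> t powr \<beta> * l t" and anti: "antimono_on {0<..} (\<lambda>t. t powr \<beta> * l t)"
    and Lp: "Lp_on p {0..1} (\<lambda>t. t powr \<gamma> * l t)"
  obtains C where "0 \<le> C" "\<And>t. 0 < t \<Longrightarrow> t \<le> 1 \<Longrightarrow> t powr \<beta> * l t \<le> C * t powr (\<beta> - \<gamma> - 1 / p)"
proof
  define I where "I = (LINT t:{0..1}|lebesgue. \<bar>t powr \<gamma> * l t\<bar> powr p)"
  define c :: real where "c = 2 powr (- \<bar>\<gamma> - \<beta>\<bar>)"
  have c: "c > 0" by (simp add: c_def)
  have I0: "0 \<le> I" unfolding I_def set_lebesgue_integral_def by (intro Bochner_Integration.integral_nonneg) auto
  show "0 \<le> (2 * I) powr (1 / p) / c" using c by simp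
  fix t :: real assume t: "0 < t" "t \<le> 1"
  define L where "L = t powr \<gamma> * l t"
  have nnl: "0 \<le> l s" if "0 < s" for s using nn that by (auto simp: zero_le_mult_iff)
  have L0: "0 \<le> L" using nnl[of t] t by (simp add: L_def)
  have lower: "c * L \<le> s powr \<gamma> * l s" if s: "t / 2 \<le> s" "s \<le> t" for s
  proof -
    have s0: "0 < s" using s t by linarith
    have m1: "t powr \<beta> * l t \<le> s powr \<beta> * l s"
      using monotone_onD[OF anti, of s t] s s0 t by simp
    have m2: "c * t powr (\<gamma> - \<beta>) \<le> s powr (\<gamma> - \<beta>)"
    proof (cases "\<gamma> - \<beta> \<ge> 0")
      case True
      have "c * t powr (\<gamma> - \<beta>) = (t / 2) powr (\<gamma> - \<beta>)"
        using True t by (simp add: c_def powr_divide powr_minus_divide[symmetric] powr_minus field_simps)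
          (simp add: powr_diff)
      also have "\<dots> \<le> s powr (\<gamma> - \<beta>)" using True s t by (intro powr_mono2) auto
      finally show ?thesis .
    next
      case False
      have "c \<le> 1" using powr_mono[of "- \<bar>\<gamma> - \<beta>\<bar>" 0 "2::real"] by (simp add: c_def)
      then have "c * t powr (\<gamma> - \<beta>) \<le> t powr (\<gamma> - \<beta>)" by (simp add: mult_left_le_one_le c less_imp_le)
      also have "\<dots> \<le> s powr (\<gamma> - \<beta>)" using False s s0 by (intro powr_mono2') auto
      finally show ?thesis .
    qed
    have "(c * t powr (\<gamma> - \<beta>)) * (t powr \<beta> * l t) \<le> s powr (\<gamma> - \<beta>) * (s powr \<beta> * l s)"
      by (rule mult_mono[OF m2 m1]) (use nn t in simp_all)
    also have "s powr (\<gamma> - \<beta>) * (s powr \<beta> * l s) = s powr \<gamma> * l s"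
      by (simp flip: powr_add mult.assoc)
    also have "(c * t powr (\<gamma> - \<beta>)) * (t powr \<beta> * l t) = c * ((t powr (\<gamma> - \<beta>) * t powr \<beta>) * l t)"
      by (simp only: mult_ac)
    also have "t powr (\<gamma> - \<beta>) * t powr \<beta> = t powr \<gamma>" by (simp flip: powr_add)
    finally show ?thesis by (simp add: L_def)
  qed
  have int: "set_integrable lebesgue {0..1} (\<lambda>t. \<bar>t powr \<gamma> * l t\<bar> powr p)"
    using Lp by (simp add: Lp_on_def)
  have "(c * L) powr p * (t / 2) = (LINT s|lebesgue. (c * L) powr p * indicator {t / 2..t} s)"
    using t by simp
  also have "\<dots> \<le> I"
    unfolding I_def set_lebesgue_integral_def
  proof (rule integral_mono)
    show "integrable lebesgue (\<lambda>s. (c * L) powr p * indicator {t / 2..t} s)"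
      by (intro integrable_mult_right integrable_real_indicator) (use t in auto)
    show "integrable lebesgue (\<lambda>s. indicator {0..1} s *\<^sub>R \<bar>s powr \<gamma> * l s\<bar> powr p)"
      using int by (simp add: set_integrable_def)
    fix s
    show "(c * L) powr p * indicator {t / 2..t} s \<le> indicator {0..1} s *\<^sub>R \<bar>s powr \<gamma> * l s\<bar> powr p"
    proof (cases "s \<in> {t / 2..t}")
      case True
      have "(c * L) powr p \<le> \<bar>s powr \<gamma> * l s\<bar> powr p"
        using lower[of s] True L0 c p by (intro powr_mono2) auto
      then show ?thesis using True t by (simp add: indicator_def)
    qed simp
  qed
  finally have "(c * L) powr p \<le> 2 * I / t" using t by (simp add: field_simps)
  then have "((c * L) powr p) powr (1 / p) \<le> (2 * I / t) powr (1 / p)"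
    using p by (intro powr_mono2) auto
  then have "c * L \<le> (2 * I) powr (1 / p) * t powr (- (1 / p))"
    using p L0 c t I0 by (simp add: powr_powr powr_divide powr_minus_divide)
  then have "L \<le> (2 * I) powr (1 / p) / c * t powr (- (1 / p))"
    using c by (simp add: field_simps)
  then have "t powr (\<beta> - \<gamma>) * L \<le> t powr (\<beta> - \<gamma>) * ((2 * I) powr (1 / p) / c * t powr (- (1 / p)))"
    by (intro mult_left_mono) auto
  also have "t powr (\<beta> - \<gamma>) * L = t powr \<beta> * l t"
    unfolding L_def by (simp flip: powr_add mult.assoc)
  also have "t powr (\<beta> - \<gamma>) * ((2 * I) powr (1 / p) / c * t powr (- (1 / p)))
      = (2 * I) powr (1 / p) / c * (t powr (\<beta> - \<gamma>) * t powr (- (1 / p)))" by (simp only: mult_ac)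
  also have "t powr (\<beta> - \<gamma>) * t powr (- (1 / p)) = t powr (\<beta> - \<gamma> - 1 / p)"
    by (simp flip: powr_add)
  finally show "t powr \<beta> * l t \<le> (2 * I) powr (1 / p) / c * t powr (\<beta> - \<gamma> - 1 / p)" .
qed

text \<open>
  This is where \<open>\<mu> < 1\<close> enters: growth of order \<open>R powr \<mu>\<close> is absorbed by a large enough \<open>R\<close>.
\<close>
lemma sublinear_absorption:
  fixes c0 c1 \<mu> :: real
  assumes "0 \<le> c0" "0 \<le> c1" "0 \<le> \<mu>" "\<mu> < 1"
  obtains R where "1 \<le> R" "c0 + c1 * R powr \<mu> \<le> R"
proof
  define R where "R = max 1 (c0 + c1) powr (1 / (1 - \<mu>))"
  show R: "1 \<le> R" using assms by (auto simp: R_def intro!: ge_one_powr_ge_zero)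
  have "1 \<le> R powr \<mu>" using R assms by (intro ge_one_powr_ge_zero) auto
  then have "c0 + c1 * R powr \<mu> \<le> (c0 + c1) * R powr \<mu>"
    using assms mult_left_mono[of 1 "R powr \<mu>" c0] by (simp add: algebra_simps)
  also have "\<dots> \<le> R powr (1 - \<mu>) * R powr \<mu>"
    using assms by (intro mult_right_mono) (auto simp: R_def powr_powr)
  also have "\<dots> = R" using R by (simp flip: powr_add)
  finally show "c0 + c1 * R powr \<mu> \<le> R" .
qed

text \<open>
  The class that the iteration preserves. The power \<open>t powr (\<beta> - 1)\<close> is the singularity of the free term;
  beyond 1 a decreasing function is bounded by its value at 1, so the bound on \<open>(0, 1]\<close> controls everything.
\<close>
definition decreasing_below :: "real \<Rightarrow> real \<Rightarrow> (real \<Rightarrow> real) \<Rightarrow> bool" where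
  "decreasing_below \<beta> R x \<longleftrightarrow> antimono_on {0<..} x \<and> (\<forall>t>0. 0 < x t) \<and>
     (\<forall>t. 0 < t \<and> t \<le> 1 \<longrightarrow> x t \<le> R * t powr (\<beta> - 1))"

text \<open>
  The exponents match: \<open>\<phi> (x s)\<close> grows at most like \<open>s powr (- (\<mu> * (1 - \<beta>)))\<close> at the origin, which is
  what the additional power \<open>\<mu> * (1 - \<beta>)\<close> in the bound on \<open>h\<close> compensates.
\<close>
lemma decreasing_source_of_decreasing:
  fixes \<phi> h \<kappa> :: "real \<Rightarrow> real"
  assumes phi: "\<And>t. 0 \<le> t \<Longrightarrow> 0 \<le> \<phi> t" "mono_on {0..} \<phi>" "\<And>t. 0 < t \<Longrightarrow> \<phi> t \<le> M * t powr \<mu>"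
    and M: "0 \<le> M" and mu: "0 \<le> \<mu>" and R: "0 \<le> R"
    and h: "\<And>t. 0 < t \<Longrightarrow> 0 \<le> h t" "antimono_on {0<..} h"
      "\<And>t. 0 < t \<Longrightarrow> t \<le> 1 \<Longrightarrow> h t \<le> C1 * t powr (e + \<mu> * (1 - \<beta>))"
    and k: "\<And>t. 0 < t \<Longrightarrow> 0 \<le> \<kappa> t" "antimono_on {0<..} \<kappa>"
      "\<And>t. 0 < t \<Longrightarrow> t \<le> 1 \<Longrightarrow> \<kappa> t \<le> C2 * t powr e"
    and x: "decreasing_below \<beta> R x"
  shows "decreasing_source e (C1 * M * R powr \<mu> + C2) (\<lambda>s. h s * \<phi> (x s) + \<kappa> s)"
  unfolding decreasing_source_def
proof (intro conjI allI impI)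
  have xpos: "0 < x t" if "0 < t" for t using x that by (auto simp: decreasing_below_def)
  show "antimono_on {0<..} (\<lambda>s. h s * \<phi> (x s) + \<kappa> s)"
  proof (rule monotone_onI)
    fix s t :: real assume st: "s \<in> {0<..}" "t \<in> {0<..}" "s \<le> t"
    have "x t \<le> x s" using x st by (auto simp: decreasing_below_def monotone_on_def)
    then have "\<phi> (x t) \<le> \<phi> (x s)"
      using monotone_onD[OF phi(2), of "x t" "x s"] xpos[of t] xpos[of s] st by auto
    moreover have "h t \<le> h s" "\<kappa> t \<le> \<kappa> s" using h(2) k(2) st by (auto simp: monotone_on_def)
    ultimately show "h t * \<phi> (x t) + \<kappa> t \<le> h s * \<phi> (x s) + \<kappa> s"
      using h(1)[of s] phi(1)[of "x t"] xpos[of t] st by (intro add_mono mult_mono) auto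
  qed
  fix s :: real assume "s > 0"
  then show "0 \<le> h s * \<phi> (x s) + \<kappa> s"
    using h(1) k(1) phi(1) xpos[of s] by simp
next
  fix s :: real assume s: "0 < s \<and> s \<le> 1"
  have xs: "0 < x s" "x s \<le> R * s powr (\<beta> - 1)" using x s by (auto simp: decreasing_below_def)
  have "\<phi> (x s) \<le> M * (x s) powr \<mu>" by (rule phi(3)[OF xs(1)])
  also have "\<dots> \<le> M * (R * s powr (\<beta> - 1)) powr \<mu>" using xs mu M by (intro mult_left_mono powr_mono2) auto
  also have "\<dots> = M * R powr \<mu> * s powr (- (\<mu> * (1 - \<beta>)))"
    using R s by (simp add: powr_mult powr_powr algebra_simps)
  finally have "h s * \<phi> (x s) \<le> (C1 * s powr (e + \<mu> * (1 - \<beta>))) * (M * R powr \<mu> * s powr (- (\<mu> * (1 - \<beta>))))"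
    using h(3)[of s] h(1)[of s] phi(1)[of "x s"] xs s order_trans[of 0 "h s"] by (intro mult_mono) auto
  also have "\<dots> = C1 * M * R powr \<mu> * (s powr (e + \<mu> * (1 - \<beta>)) * s powr (- (\<mu> * (1 - \<beta>))))"
    by (simp only: mult_ac)
  also have "s powr (e + \<mu> * (1 - \<beta>)) * s powr (- (\<mu> * (1 - \<beta>))) = s powr e"
    by (simp flip: powr_add)
  finally show "h s * \<phi> (x s) + \<kappa> s \<le> (C1 * M * R powr \<mu> + C2) * s powr e"
    using k(3)[of s] s by (simp add: algebra_simps)
qed

section \<open>Properties of the Volterra right-hand side\<close>

text \<open>
  The mean is only nonincreasing; strictness comes from the free term, since \<open>x0 > 0\<close>.
\<close>
lemma volterra_rhs_decreasing:
  assumes b: "0 < \<beta>" "\<beta> < 1" "\<beta> - 1 < e" and g: "decreasing_source e C g" and x0: "0 < x0"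
    and R: "x0 + C * Beta (e + 1 - \<beta>) \<beta> / Gamma \<beta> \<le> R" and C: "0 \<le> C"
  shows "decreasing_below \<beta> R (volterra_rhs \<beta> x0 g)" and "strict_antimono_on {0<..} (volterra_rhs \<beta> x0 g)"
proof -
  have G: "Gamma \<beta> > 0" using b by (auto intro: Gamma_real_pos)
  have B: "Beta (e + 1 - \<beta>) \<beta> \<ge> 0" using b by (simp add: Beta_def Gamma_real_pos less_imp_le)
  show strict: "strict_antimono_on {0<..} (volterra_rhs \<beta> x0 g)"
  proof (rule monotone_onI)
    fix s t :: real assume st: "s \<in> {0<..}" "t \<in> {0<..}" "s < t"
    have "t powr (\<beta> - 1) < s powr (\<beta> - 1)" using st b by (intro powr_less_mono2_neg) auto
    then have "x0 * t powr (\<beta> - 1) < x0 * s powr (\<beta> - 1)" using x0 by simp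
    moreover have "abel_mean \<beta> g t / Gamma \<beta> \<le> abel_mean \<beta> g s / Gamma \<beta>"
      using abel_mean_antimono[OF b(1,3) g, of s t] st G by (intro divide_right_mono) auto
    ultimately show "volterra_rhs \<beta> x0 g s > volterra_rhs \<beta> x0 g t"
      using st by (simp add: volterra_rhs_def)
  qed
  show "decreasing_below \<beta> R (volterra_rhs \<beta> x0 g)"
    unfolding decreasing_below_def
  proof (intro conjI allI impI)
    show "antimono_on {0<..} (volterra_rhs \<beta> x0 g)"
      using strict by (auto simp: monotone_on_def order_le_less)
    fix t :: real assume t: "t > 0"
    show "0 < volterra_rhs \<beta> x0 g t"
      using t x0 G abel_mean_nonneg[OF g t, of \<beta>] by (simp add: volterra_rhs_def add_pos_nonneg)
  next
    fix t :: real assume t: "0 < t \<and> t \<le> 1"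
    have "C * t powr e * Beta (e + 1 - \<beta>) \<beta> \<le> C * t powr (\<beta> - 1) * Beta (e + 1 - \<beta>) \<beta>"
      using t b B C by (intro mult_right_mono mult_left_mono powr_mono') auto
    then have "abel_mean \<beta> g t / Gamma \<beta> \<le> C * t powr (\<beta> - 1) * Beta (e + 1 - \<beta>) \<beta> / Gamma \<beta>"
      using abel_mean_le[OF b(1,3) g, of t] t G by (intro divide_right_mono) auto
    then have "volterra_rhs \<beta> x0 g t \<le> (x0 + C * Beta (e + 1 - \<beta>) \<beta> / Gamma \<beta>) * t powr (\<beta> - 1)"
      using t by (simp add: volterra_rhs_def algebra_simps)
    also have "\<dots> \<le> R * t powr (\<beta> - 1)" using R by (intro mult_right_mono) auto
    finally show "volterra_rhs \<beta> x0 g t \<le> R * t powr (\<beta> - 1)" .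
  qed
qed

lemma volterra_rhs_continuous:
  assumes b: "0 < \<beta>" "\<beta> < 1" "\<beta> - 1 < e" and g: "decreasing_source e C g"
  shows "continuous_on {0<..} (volterra_rhs \<beta> x0 g)"
proof -
  have "Gamma \<beta> \<noteq> 0" using Gamma_real_pos[OF b(1)] by simp
  then have "continuous_on {0<..} (\<lambda>t. x0 * t powr (\<beta> - 1) + abel_mean \<beta> g t / Gamma \<beta>)"
    by (intro continuous_intros abel_mean_continuous[OF b(1,3) g]) auto
  then show ?thesis
    by (rule continuous_on_cong[THEN iffD1, rotated -1]) (auto simp: volterra_rhs_def)
qed

lemma volterra_rhs_initial:
  assumes b: "0 < \<beta>" "\<beta> < 1" "\<beta> - 1 < e" and g: "decreasing_source e C g"
  shows "((\<lambda>t. t powr (1 - \<beta>) * volterra_rhs \<beta> x0 g t) \<longlongrightarrow> x0) (at_right 0)"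
proof -
  have G: "Gamma \<beta> > 0" using b by (auto intro: Gamma_real_pos)
  let ?B = "Beta (e + 1 - \<beta>) \<beta>"
  have near: "\<forall>\<^sub>F t in at_right 0. (0::real) < t \<and> t \<le> 1"
    using eventually_at_right_less[of "0::real"] eventually_at_right_real[of 0 1]
    by (auto elim: eventually_mono)
  have "((\<lambda>t. t powr (1 - \<beta>) * (abel_mean \<beta> g t / Gamma \<beta>)) \<longlongrightarrow> 0) (at_right 0)"
  proof (rule tendsto_sandwich)
    show "\<forall>\<^sub>F t in at_right 0. 0 \<le> t powr (1 - \<beta>) * (abel_mean \<beta> g t / Gamma \<beta>)"
      using near by eventually_elim (use G abel_mean_nonneg[OF g] in auto)
    show "\<forall>\<^sub>F t in at_right 0. t powr (1 - \<beta>) * (abel_mean \<beta> g t / Gamma \<beta>) \<le> C * ?B / Gamma \<beta> * t powr (e + 1 - \<beta>)"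
      using near
    proof eventually_elim
      fix t :: real assume t: "0 < t \<and> t \<le> 1"
      then have "t powr (1 - \<beta>) * (abel_mean \<beta> g t / Gamma \<beta>) \<le> t powr (1 - \<beta>) * (C * t powr e * ?B / Gamma \<beta>)"
        using abel_mean_le[OF b(1,3) g, of t] G by (intro mult_left_mono divide_right_mono) auto
      also have "\<dots> = C * ?B / Gamma \<beta> * (t powr (1 - \<beta>) * t powr e)" by simp
      also have "t powr (1 - \<beta>) * t powr e = t powr (e + 1 - \<beta>)" by (simp flip: powr_add add: algebra_simps)
      finally show "t powr (1 - \<beta>) * (abel_mean \<beta> g t / Gamma \<beta>) \<le> C * ?B / Gamma \<beta> * t powr (e + 1 - \<beta>)" .
    qed
    have "((\<lambda>t. t powr (e + 1 - \<beta>)) \<longlongrightarrow> 0 powr (e + 1 - \<beta>)) (at_right 0)"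
      by (rule tendsto_powr2) (use b near in \<open>auto elim: eventually_mono\<close>)
    then show "((\<lambda>t. C * ?B / Gamma \<beta> * t powr (e + 1 - \<beta>)) \<longlongrightarrow> 0) (at_right 0)"
      by (intro tendsto_mult_right_zero) simp
  qed simp
  then have "((\<lambda>t. x0 + t powr (1 - \<beta>) * (abel_mean \<beta> g t / Gamma \<beta>)) \<longlongrightarrow> x0 + 0) (at_right 0)"
    by (intro tendsto_intros)
  then have "((\<lambda>t. x0 + t powr (1 - \<beta>) * (abel_mean \<beta> g t / Gamma \<beta>)) \<longlongrightarrow> x0) (at_right 0)" by simp
  then show ?thesis
  proof (rule Lim_transform_eventually)
    show "\<forall>\<^sub>F t in at_right 0. x0 + t powr (1 - \<beta>) * (abel_mean \<beta> g t / Gamma \<beta>) = t powr (1 - \<beta>) * volterra_rhs \<beta> x0 g t"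
      using near
    proof eventually_elim
      fix t :: real assume t: "0 < t \<and> t \<le> 1"
      have "t powr (1 - \<beta>) * t powr (\<beta> - 1) = 1" using t by (simp flip: powr_add)
      then have "t powr (1 - \<beta>) * (x0 * t powr (\<beta> - 1)) = x0" by (simp add: mult.left_commute)
      then show "x0 + t powr (1 - \<beta>) * (abel_mean \<beta> g t / Gamma \<beta>) = t powr (1 - \<beta>) * volterra_rhs \<beta> x0 g t"
        using t by (simp add: volterra_rhs_def distrib_left)
    qed
  qed
qed

lemma volterra_rhs_at_top:
  assumes b: "0 < \<beta>" "\<beta> < 1" "\<beta> - 1 < e" and g: "decreasing_source e C g" and lim: "(g \<longlongrightarrow> L) at_top"
  shows "(volterra_rhs \<beta> x0 g \<longlongrightarrow> L * pi / (Gamma \<beta> * sin (\<beta> * pi))) at_top"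
proof -
  have "Gamma \<beta> \<noteq> 0" using Gamma_real_pos[OF b(1)] by simp
  moreover have "((\<lambda>t. t powr (\<beta> - 1)) \<longlongrightarrow> 0) at_top"
    using b tendsto_neg_powr[of "\<beta> - 1" "\<lambda>t. t" at_top] by (simp add: filterlim_ident)
  ultimately have "((\<lambda>t. x0 * t powr (\<beta> - 1) + abel_mean \<beta> g t / Gamma \<beta>)
      \<longlongrightarrow> x0 * 0 + L * (pi / sin (\<beta> * pi)) / Gamma \<beta>) at_top"
    by (intro tendsto_intros abel_mean_at_top[OF b g lim])
  then have "((\<lambda>t. x0 * t powr (\<beta> - 1) + abel_mean \<beta> g t / Gamma \<beta>)
      \<longlongrightarrow> L * pi / (Gamma \<beta> * sin (\<beta> * pi))) at_top" by (simp add: mult.commute)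
  then show ?thesis
    by (rule Lim_transform_eventually)
       (use eventually_gt_at_top[of 0] in \<open>eventually_elim, simp add: volterra_rhs_def\<close>)
qed

text \<open>
  The initial condition itself provides the continuous extension to the origin, with value \<open>x0\<close>.
\<close>
lemma Cplus_of_initial:
  assumes cont: "continuous_on {0<..} x" and nn: "\<And>t. 0 < t \<Longrightarrow> 0 \<le> x t" and x0: "0 \<le> x0"
    and lim: "((\<lambda>t. t powr \<alpha> * x t) \<longlongrightarrow> x0) (at_right 0)"
  shows "x \<in> Cplus \<alpha>"
proof -
  define g where "g t = (if t \<le> 0 then x0 else t powr \<alpha> * x t)" for t
  have "continuous (at t within {0..}) g" if t: "t \<ge> 0" for t
  proof (cases "t = 0")
    case True
    have "(g \<longlongrightarrow> x0) (at_right 0)"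
      using lim by (rule Lim_transform_eventually)
        (use eventually_at_right_less[of "0::real"] in \<open>eventually_elim, simp add: g_def\<close>)
    then show ?thesis
      using True by (simp add: continuous_within g_def at_within_Ici_at_right)
  next
    case False
    have "continuous_on {0<..} (\<lambda>t. t powr \<alpha> * x t)" by (intro continuous_intros cont) auto
    then have "continuous_on {0<..} g"
      by (rule continuous_on_cong[THEN iffD1, rotated -1]) (auto simp: g_def)
    then have "continuous (at t) g"
      using False t by (simp add: continuous_on_eq_continuous_at)
    then show ?thesis by (rule continuous_at_imp_continuous_at_within)
  qed
  then have "continuous_on {0..} g" by (simp add: continuous_on_eq_continuous_within)
  moreover have "\<forall>t\<ge>0. 0 \<le> g t" "\<forall>t>0. g t = t powr \<alpha> * x t"
    using nn x0 by (auto simp: g_def)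
  ultimately show ?thesis using cont nn by (auto simp: Cplus_def)
qed

section \<open>The monotone iteration\<close>

text \<open>
  Starting from the free term, which lies below its image under the Volterra operator, the iterates
  increase in \<open>n\<close>, since the operator is order preserving, and decrease in \<open>t\<close>. The bound \<open>R\<close> is
  reproduced by the operator, so the iterates converge pointwise; the limit inherits monotonicity in
  \<open>t\<close> and, by dominated convergence, solves the equation.
\<close>
lemma monotone_abel_fixed_point:
  fixes G :: "(real \<Rightarrow> real) \<Rightarrow> real \<Rightarrow> real"
  assumes b: "0 < \<beta>" "\<beta> < 1" "\<beta> - 1 < e" and x0: "0 < x0" and C: "0 \<le> C"
    and R: "x0 + C * Beta (e + 1 - \<beta>) \<beta> / Gamma \<beta> \<le> R"
    and source: "\<And>x. decreasing_below \<beta> R x \<Longrightarrow> decreasing_source e C (G x)"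
    and mono: "\<And>x y s. decreasing_below \<beta> R x \<Longrightarrow> decreasing_below \<beta> R y \<Longrightarrow>
        (\<And>t. 0 < t \<Longrightarrow> x t \<le> y t) \<Longrightarrow> 0 < s \<Longrightarrow> G x s \<le> G y s"
    and cont: "\<And>X x s. (\<And>n. decreasing_below \<beta> R (X n)) \<Longrightarrow> decreasing_below \<beta> R x \<Longrightarrow>
        (\<And>t. 0 < t \<Longrightarrow> (\<lambda>n. X n t) \<longlonglongrightarrow> x t) \<Longrightarrow> 0 < s \<Longrightarrow> (\<lambda>n. G (X n) s) \<longlonglongrightarrow> G x s"
  obtains x where "decreasing_below \<beta> R x" "\<And>t. 0 < t \<Longrightarrow> x t = volterra_rhs \<beta> x0 (G x) t"
proof -
  have Gam: "Gamma \<beta> > 0" using b by (auto intro: Gamma_real_pos)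
  have B: "Beta (e + 1 - \<beta>) \<beta> \<ge> 0" using b by (simp add: Beta_def Gamma_real_pos less_imp_le)
  define T where "T x = volterra_rhs \<beta> x0 (G x)" for x
  define X where "X n = (T ^^ n) (\<lambda>t. x0 * t powr (\<beta> - 1))" for n
  have X_Suc: "X (Suc n) = T (X n)" for n by (simp add: X_def)
  have dec: "decreasing_below \<beta> R (X n)" for n
  proof (induction n)
    case 0
    have "0 \<le> C * Beta (e + 1 - \<beta>) \<beta> / Gamma \<beta>" using C B Gam by simp
    with R have "x0 \<le> R" by linarith
    moreover have "antimono_on {0<..} (\<lambda>t. x0 * t powr (\<beta> - 1))"
      using x0 b by (intro monotone_onI mult_left_mono powr_mono2') auto
    ultimately show ?case using x0 by (auto simp: decreasing_below_def X_def intro!: mult_right_mono)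
  next
    case (Suc n)
    then show ?case unfolding X_Suc T_def by (intro volterra_rhs_decreasing[OF b source x0 R C])
  qed
  have step: "X n t \<le> X (Suc n) t" if "0 < t" for n t
    using that
  proof (induction n arbitrary: t)
    case 0
    then show ?case
      using abel_mean_nonneg[OF source[OF dec[of 0]] 0, of \<beta>] Gam unfolding X_Suc
      by (simp add: T_def volterra_rhs_def) (simp add: X_def)
  next
    case (Suc n)
    have "abel_mean \<beta> (G (X n)) t \<le> abel_mean \<beta> (G (X (Suc n))) t"
      using Suc by (intro abel_mean_mono[OF b(1,3) source[OF dec] source[OF dec]] mono[OF dec dec])
    then show ?case
      using Suc.prems Gam unfolding X_Suc[of "Suc n"] X_Suc[of n] T_def
      by (simp add: volterra_rhs_def divide_right_mono)
  qed
  have inc: "incseq (\<lambda>n. X n t)" if "0 < t" for t using step[OF that] by (intro incseq_SucI)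
  have bound: "X n t \<le> R * min t 1 powr (\<beta> - 1)" if "0 < t" for n t
  proof -
    have "X n t \<le> X n (min t 1)"
      using dec[of n] that by (auto simp: decreasing_below_def monotone_on_def)
    also have "\<dots> \<le> R * min t 1 powr (\<beta> - 1)" using dec[of n] that by (auto simp: decreasing_below_def)
    finally show ?thesis .
  qed
  define x where "x t = (SUP n. X n t)" for t
  have lim: "(\<lambda>n. X n t) \<longlonglongrightarrow> x t" if "0 < t" for t
    unfolding x_def using bound[OF that] by (intro LIMSEQ_incseq_SUP inc[OF that] bdd_aboveI2)
  have Xle: "X n t \<le> x t" if "0 < t" for n t by (rule incseq_le[OF inc[OF that] lim[OF that]])
  have xdec: "decreasing_below \<beta> R x"
    unfolding decreasing_below_def
  proof (intro conjI allI impI)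
    show "antimono_on {0<..} x"
    proof (rule monotone_onI)
      fix s t :: real assume st: "s \<in> {0<..}" "t \<in> {0<..}" "s \<le> t"
      have "X n t \<le> X n s" for n using dec[of n] st by (auto simp: decreasing_below_def monotone_on_def)
      then show "x t \<le> x s" using st by (intro LIMSEQ_le[OF lim lim]) auto
    qed
    fix t :: real assume "t > 0"
    then show "0 < x t" using dec[of 0] Xle[of t 0] by (auto simp: decreasing_below_def intro: less_le_trans)
  next
    fix t :: real assume "0 < t \<and> t \<le> 1"
    then show "x t \<le> R * t powr (\<beta> - 1)"
      using bound[of t] by (intro LIMSEQ_le_const2[OF lim]) auto
  qed
  have "x t = volterra_rhs \<beta> x0 (G x) t" if t: "0 < t" for t
  proof (rule LIMSEQ_unique)
    show "(\<lambda>n. X (Suc n) t) \<longlonglongrightarrow> x t" using lim[OF t] by (rule LIMSEQ_Suc)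
    have "(\<lambda>n. abel_mean \<beta> (G (X n)) t) \<longlonglongrightarrow> abel_mean \<beta> (G x) t"
      by (intro abel_mean_converges[OF b(1,3) source[OF dec] t _ source[OF xdec]]
          cont[OF dec xdec lim] mono[OF dec xdec Xle]) auto
    then have "(\<lambda>n. x0 * t powr (\<beta> - 1) + abel_mean \<beta> (G (X n)) t / Gamma \<beta>)
        \<longlonglongrightarrow> x0 * t powr (\<beta> - 1) + abel_mean \<beta> (G x) t / Gamma \<beta>"
      using Gam by (intro tendsto_intros) auto
    then show "(\<lambda>n. X (Suc n) t) \<longlonglongrightarrow> volterra_rhs \<beta> x0 (G x) t"
      using t by (simp add: X_Suc T_def volterra_rhs_def)
  qed
  with xdec show thesis by (rule that)
qed

section \<open>Existence of a decreasing solution\<close>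

theorem theorem3p3:
  fixes \<beta> x0 \<mu> p a b :: real and \<phi> l k :: "real \<Rightarrow> real"
  assumes "0 < \<beta>" and "\<beta> < 1" and "0 < x0" and "0 \<le> \<mu>" and "\<mu> < 1" and "p > 1 / \<beta>"
    and phi: "\<forall>t\<ge>0. 0 \<le> \<phi> t" "continuous_on {0..} \<phi>" "mono_on {0..} \<phi>"
      "\<exists>M\<ge>0. \<forall>t\<ge>0. \<bar>\<phi> t\<bar> \<le> M * rpow t \<mu>"
    and l: "\<forall>t>0. 0 \<le> t powr \<beta> * l t" "continuous_on {0<..} (\<lambda>t. t powr \<beta> * l t)"
      "antimono_on {0<..} (\<lambda>t. t powr \<beta> * l t)"
      "Lp_on p {0..1} (\<lambda>t. t powr ((1 - \<mu>) * (1 - \<beta>)) * l t)"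
    and k: "\<forall>t>0. 0 \<le> t powr \<beta> * k t" "continuous_on {0<..} (\<lambda>t. t powr \<beta> * k t)"
      "antimono_on {0<..} (\<lambda>t. t powr \<beta> * k t)"
      "Lp_on p {0..1} (\<lambda>t. t powr (1 - \<beta>) * k t)"
    and a: "((\<lambda>t. t powr \<beta> * l t) \<longlongrightarrow> a) at_top"
    and b: "((\<lambda>t. t powr \<beta> * k t) \<longlongrightarrow> b) at_top"
    and "a = 0"
  shows "\<exists>x. rl_solution \<beta> l \<phi> k x0 x \<and> x \<in> Cplus (1 - \<beta>) \<and> strict_antimono_on {0<..} x \<and>
    (x \<longlongrightarrow> b * pi / (Gamma \<beta> * sin (\<beta> * pi))) at_top"
proof -
  \<comment> \<open>The pointwise bounds from the \<open>L\<^sup>p\<close> conditions give this exponent; \<open>p > 1 / \<beta>\<close> says \<open>e > \<beta> - 1\<close>.\<close>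
  define e where "e = 2 * \<beta> - 1 - 1 / p"
  have p: "0 < p" using \<open>p > 1 / \<beta>\<close> \<open>0 < \<beta>\<close> by (smt (verit) divide_pos_pos)
  have "1 / p < \<beta>" using \<open>p > 1 / \<beta>\<close> \<open>0 < \<beta>\<close> p by (simp add: field_simps)
  then have beta: "0 < \<beta>" "\<beta> < 1" "\<beta> - 1 < e" using assms(1,2) by (auto simp: e_def)
  have Gam: "Gamma \<beta> > 0" using beta by (auto intro: Gamma_real_pos)
  define K where "K = Beta (e + 1 - \<beta>) \<beta> / Gamma \<beta>"
  have K: "0 \<le> K" using beta by (simp add: K_def Beta_def Gamma_real_pos less_imp_le)
  obtain M where M: "0 \<le> M" "\<And>t. 0 \<le> t \<Longrightarrow> \<bar>\<phi> t\<bar> \<le> M * rpow t \<mu>" using phi(4) by blast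
  have phiM: "\<phi> t \<le> M * t powr \<mu>" if "0 < t" for t
    using M(2)[of t] that by (auto simp: rpow_def split: if_splits)
  define h where "h t = t powr \<beta> * l t" for t
  define \<kappa> where "\<kappa> t = t powr \<beta> * k t" for t
  obtain C1 where C1: "0 \<le> C1" "\<And>t. 0 < t \<Longrightarrow> t \<le> 1 \<Longrightarrow> h t \<le> C1 * t powr (e + \<mu> * (1 - \<beta>))"
  proof (rule Lp_antimono_pointwise_bound[OF p l(1,3,4)])
    fix C assume C: "0 \<le> C" "\<And>t. 0 < t \<Longrightarrow> t \<le> 1 \<Longrightarrow>
      t powr \<beta> * l t \<le> C * t powr (\<beta> - (1 - \<mu>) * (1 - \<beta>) - 1 / p)"
    have "\<beta> - (1 - \<mu>) * (1 - \<beta>) - 1 / p = e + \<mu> * (1 - \<beta>)" by (simp add: e_def algebra_simps)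
    with C show thesis by (intro that[of C]) (auto simp: h_def)
  qed
  obtain C2 where C2: "0 \<le> C2" "\<And>t. 0 < t \<Longrightarrow> t \<le> 1 \<Longrightarrow> \<kappa> t \<le> C2 * t powr e"
  proof (rule Lp_antimono_pointwise_bound[OF p k(1,3,4)])
    fix C assume C: "0 \<le> C" "\<And>t. 0 < t \<Longrightarrow> t \<le> 1 \<Longrightarrow> t powr \<beta> * k t \<le> C * t powr (\<beta> - (1 - \<beta>) - 1 / p)"
    have "\<beta> - (1 - \<beta>) - 1 / p = e" by (simp add: e_def)
    with C show thesis by (intro that[of C]) (auto simp: \<kappa>_def)
  qed
  obtain R where R: "1 \<le> R" "(x0 + C2 * K) + (C1 * M * K) * R powr \<mu> \<le> R"
    using sublinear_absorption[of "x0 + C2 * K" "C1 * M * K" \<mu>] assms(3-5) C1(1) C2(1) K M(1) by auto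
  define C where "C = C1 * M * R powr \<mu> + C2"
  have C: "0 \<le> C" using C1(1) C2(1) M(1) by (simp add: C_def)
  have RC: "x0 + C * Beta (e + 1 - \<beta>) \<beta> / Gamma \<beta> \<le> R"
    using R(2) by (simp add: C_def K_def algebra_simps add_divide_distrib)
  define G where "G x s = h s * \<phi> (x s) + \<kappa> s" for x :: "real \<Rightarrow> real" and s
  have hk: "0 \<le> h t" "0 \<le> \<kappa> t" if "0 < t" for t using l(1) k(1) that by (auto simp: h_def \<kappa>_def)
  have source: "decreasing_source e C (G x)" if "decreasing_below \<beta> R x" for x
    unfolding C_def G_def
    by (rule decreasing_source_of_decreasing[OF _ phi(3) phiM M(1) _ _ _ _ C1(2) _ _ C2(2) that])
       (use phi(1) R(1) l(3) k(3) hk assms(4) in \<open>auto simp: h_def[abs_def] \<kappa>_def[abs_def]\<close>)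
  obtain x where x: "decreasing_below \<beta> R x" "\<And>t. 0 < t \<Longrightarrow> x t = volterra_rhs \<beta> x0 (G x) t"
  proof (rule monotone_abel_fixed_point[OF beta assms(3) C RC source])
    fix x y :: "real \<Rightarrow> real" and s :: real
    assume xy: "decreasing_below \<beta> R x" "decreasing_below \<beta> R y" "\<And>t. 0 < t \<Longrightarrow> x t \<le> y t" and s: "0 < s"
    have "\<phi> (x s) \<le> \<phi> (y s)"
      using monotone_onD[OF phi(3), of "x s" "y s"] xy s by (auto simp: decreasing_below_def less_imp_le)
    then show "G x s \<le> G y s" using hk[OF s] by (simp add: G_def mult_left_mono)
  next
    fix X :: "nat \<Rightarrow> real \<Rightarrow> real" and x :: "real \<Rightarrow> real" and s :: real
    assume X: "\<And>n. decreasing_below \<beta> R (X n)" "decreasing_below \<beta> R x"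
      "\<And>t. 0 < t \<Longrightarrow> (\<lambda>n. X n t) \<longlonglongrightarrow> x t" and s: "0 < s"
    have "(\<lambda>n. \<phi> (X n s)) \<longlonglongrightarrow> \<phi> (x s)"
      by (rule continuous_on_tendsto_compose[OF phi(2) X(3)[OF s]])
         (use X(1,2) s in \<open>auto simp: decreasing_below_def less_imp_le\<close>)
    then show "(\<lambda>n. G (X n) s) \<longlonglongrightarrow> G x s" unfolding G_def by (intro tendsto_intros)
  qed (use that in auto)
  \<comment> \<open>The fixed point is only determined on the positive half-line; \<open>y\<close> is its measurable extension by 0.\<close>
  define y where "y = volterra_rhs \<beta> x0 (G x)"
  have y: "y t = x t" if "0 < t" for t using x(2)[OF that] by (simp add: y_def)
  have xpos: "0 < x t" if "0 < t" for t using x(1) that by (auto simp: decreasing_below_def)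
  note g = source[OF x(1)]
  have ycont: "continuous_on {0<..} y" unfolding y_def by (rule volterra_rhs_continuous[OF beta g])
  then have "continuous_on {0<..} x" by (rule continuous_on_cong[THEN iffD1, rotated -1]) (auto simp: y)
  then have "continuous_on {0<..} (\<lambda>s. \<phi> (x s))"
    by (rule continuous_on_compose2[OF phi(2)]) (auto dest: xpos intro: less_imp_le)
  then have gcont: "continuous_on {0<..} (G x)"
    unfolding G_def[abs_def] h_def \<kappa>_def by (intro continuous_on_add continuous_on_mult l(2) k(2))
  \<comment> \<open>As \<open>x\<close> decreases, \<open>\<phi> (x s)\<close> stays bounded, so \<open>a = 0\<close> removes the nonlinear part from the limit.\<close>
  have "((\<lambda>s. h s * \<phi> (x s)) \<longlongrightarrow> 0) at_top"
  proof (rule tendsto_sandwich)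
    show "\<forall>\<^sub>F s in at_top. 0 \<le> h s * \<phi> (x s)"
      using eventually_gt_at_top[of 0] by eventually_elim (use hk phi(1) xpos in \<open>auto simp: less_imp_le\<close>)
    show "\<forall>\<^sub>F s in at_top. h s * \<phi> (x s) \<le> h s * \<phi> (x 1)"
      using eventually_ge_at_top[of 1]
    proof eventually_elim
      fix s :: real assume s: "1 \<le> s"
      have "x s \<le> x 1" using x(1) s by (auto simp: decreasing_below_def monotone_on_def)
      then have "\<phi> (x s) \<le> \<phi> (x 1)"
        using monotone_onD[OF phi(3), of "x s" "x 1"] xpos[of s] xpos[of 1] s by auto
      then show "h s * \<phi> (x s) \<le> h s * \<phi> (x 1)" using hk[of s] s by (intro mult_left_mono) auto
    qed
    show "((\<lambda>s. h s * \<phi> (x 1)) \<longlongrightarrow> 0) at_top"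
      using a \<open>a = 0\<close> by (intro tendsto_mult_left_zero) (simp add: h_def)
  qed simp
  from tendsto_add[OF this b] have glim: "(G x \<longlongrightarrow> b) at_top"
    by (simp add: G_def[abs_def] \<kappa>_def)
  have init: "((\<lambda>t. t powr (1 - \<beta>) * y t) \<longlongrightarrow> x0) (at_right 0)"
    unfolding y_def by (rule volterra_rhs_initial[OF beta g])
  have "has_rl_derivative \<beta> y (\<lambda>t. l t * \<phi> (y t) + k t)"
    unfolding y_def
  proof (rule volterra_rhs_has_rl_derivative[OF beta g gcont])
    fix t :: real assume t: "0 < t"
    have "t powr (- \<beta>) * t powr \<beta> = 1" using t by (simp flip: powr_add)
    then have c: "t powr (- \<beta>) * (t powr \<beta> * z) = z" for z by (simp flip: mult.assoc)
    have "t powr (- \<beta>) * G x t = l t * \<phi> (x t) + k t"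
      by (simp only: G_def h_def \<kappa>_def distrib_left mult.assoc c)
    then show "l t * \<phi> (volterra_rhs \<beta> x0 (G x) t) + k t = t powr (- \<beta>) * G x t"
      using x(2)[OF t] by simp
  qed (use assms(3) in simp)
  moreover have "y \<in> Cplus (1 - \<beta>)"
    using assms(3) xpos y by (intro Cplus_of_initial[OF ycont _ _ init]) (auto simp: less_imp_le)
  moreover have "strict_antimono_on {0<..} y"
    unfolding y_def by (rule volterra_rhs_decreasing(2)[OF beta g assms(3) RC C])
  moreover have "(y \<longlongrightarrow> b * pi / (Gamma \<beta> * sin (\<beta> * pi))) at_top"
    unfolding y_def by (rule volterra_rhs_at_top[OF beta g glim])
  ultimately show ?thesis using init unfolding rl_solution_def by blast
qed

end
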